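(* Let $\mathcal{C}\subset\mathbb{R}^n$ be nonempty, closed and convex. Let $\Phi:\mathbb{R}^n\to\mathbb{R}$ be continuously differentiable in a neighborhood of $\mathcal{C}$ and such that the sublevel sets $\mathcal{S}_{\ell}:=\{x\in\mathcal{C}\mid \Phi(x)\le \ell\}$ are compact for all $\ell\in\mathbb{R}$. Then, for all $K>0$ and all $x(0)\in\mathbb{R}^n$, the system $$\dot x=-\nabla\Phi(P_{\mathcal{C}}(x))-\tfrac1K\left(x-P_{\mathcal{C}}(x)\right)$$ admits a complete solution $x:[0,\infty)\to\mathbb{R}^n$. Further, for any such solution, the projected trajectory $\overline{x}:=P_{\mathcal{C}}\circ x$ converges (as $t\to\infty$) to the set of critical points of the problem: minimize $\Phi(x)$ subject to $x\in\mathcal{C}$.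
   Context: $\mathbb{R}^n$ carries the usual inner product and 2-norm. $P_{\mathcal{C}}(x)$ is the Euclidean projection of $x$ onto the closed convex set $\mathcal{C}$ (single-valued). $N_x\mathcal{C}$ is the normal cone of $\mathcal{C}$ at $x\in\mathcal{C}$ (the polar of the tangent cone). A solution on $[0,T]$, $T>0$, is an absolutely continuous map satisfying the differential equation for almost all $t\in[0,T]$; a complete solution is a map on $[0,\infty)$ whose restriction to every compact subinterval $[0,T]$ is a solution. A point $x^\star\in\mathcal{C}$ is a critical point of the problem "minimize $\Phi(x)$ subject to $x\in\mathcal{C}$" if $\nabla\Phi(x^\star)\in-N_{x^\star}\mathcal{C}$. Convergence of a trajectory to a set means that its distance to the set tends to zero as $t\to\infty$. *)

theory Defs
  imports "HOL-Analysis.Analysis"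
begin

text \<open>The gradient is only meaningful at points of differentiability; \<open>closest_point C\<close> from the
  library is the Euclidean projection onto a nonempty closed convex set \<open>C\<close>.\<close>

definition gradient :: "('a::euclidean_space \<Rightarrow> real) \<Rightarrow> 'a \<Rightarrow> 'a" where
  "gradient f x = (THE g. GDERIV f x :> g)"

lemma gradient_eqI:
  assumes "GDERIV f x :> g"
  shows "gradient f x = g"
  unfolding gradient_def
proof (rule the_equality)
  show "GDERIV f x :> g" by fact
next
  fix g' assume "GDERIV f x :> g'"
  with assms have "(\<lambda>h. h \<bullet> g') = (\<lambda>h. h \<bullet> g)"
    unfolding gderiv_def using has_derivative_unique by blast
  then have "\<forall>h. h \<bullet> g' = h \<bullet> g"
    by (simp add: fun_eq_iff)
  then show "g' = g"
    by (simp only: vector_eq_ldot)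
qed

lemma differentiable_GDERIV_gradient:
  assumes "f differentiable (at x)"
  shows "GDERIV f x :> gradient f x"
proof -
  obtain D where D: "(f has_derivative D) (at x)"
    using assms by (auto simp: differentiable_def)
  have lin: "linear D"
    using D by (rule has_derivative_linear)
  have "D = (\<lambda>h. h \<bullet> adjoint D 1)"
  proof
    fix h show "D h = h \<bullet> adjoint D 1"
      using adjoint_works[OF lin, of h 1] by (simp only: inner_real_def mult_1_right)
  qed
  with D have "GDERIV f x :> adjoint D 1"
    unfolding gderiv_def by (simp only:)
  then show ?thesis
    by (simp only: gradient_eqI)
qed

definition continuously_differentiable_near ::
    "('a::euclidean_space \<Rightarrow> real) \<Rightarrow> 'a set \<Rightarrow> bool" where
  "continuously_differentiable_near f C \<longleftrightarrow>
     (\<exists>U. open U \<and> C \<subseteq> U \<and> (\<forall>x\<in>U. f differentiable (at x)) \<and> continuous_on U (gradient f))"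

text \<open>The Bouligand (contingent) tangent cone and its polar.\<close>

definition tangent_cone :: "'a::euclidean_space set \<Rightarrow> 'a \<Rightarrow> 'a set" where
  "tangent_cone C x =
     {v. \<exists>(y :: nat \<Rightarrow> 'a) (\<delta> :: nat \<Rightarrow> real).
           (\<forall>k. y k \<in> C) \<and> y \<longlonglongrightarrow> x \<and> (\<forall>k. \<delta> k > 0) \<and> \<delta> \<longlonglongrightarrow> 0 \<and>
           (\<lambda>k. (y k - x) /\<^sub>R \<delta> k) \<longlonglongrightarrow> v}"

definition polar_cone :: "'a::euclidean_space set \<Rightarrow> 'a set" where
  "polar_cone K = {w. \<forall>v\<in>K. w \<bullet> v \<le> 0}"

definition normal_cone :: "'a::euclidean_space set \<Rightarrow> 'a \<Rightarrow> 'a set" where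
  "normal_cone C x = polar_cone (tangent_cone C x)"

definition critical_points :: "('a::euclidean_space \<Rightarrow> real) \<Rightarrow> 'a set \<Rightarrow> 'a set" where
  "critical_points f C = {x \<in> C. gradient f x \<in> uminus ` normal_cone C x}"

text \<open>Absolute continuity of functions (the library constant \<open>absolutely_continuous\<close> is about
  measures). A pair \<open>(a, b)\<close> encodes the interval from \<open>a\<close> to \<open>b\<close>.\<close>

definition absolutely_continuous_fun_on ::
    "real set \<Rightarrow> (real \<Rightarrow> 'a::euclidean_space) \<Rightarrow> bool" where
  "absolutely_continuous_fun_on S f \<longleftrightarrow>
     (\<forall>\<epsilon>>0. \<exists>\<delta>>0. \<forall>P :: (real \<times> real) set.
        finite P \<and> (\<forall>(a, b)\<in>P. a \<le> b \<and> {a..b} \<subseteq> S) \<and>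
        disjoint_family_on (\<lambda>(a, b). {a<..<b}) P \<and> (\<Sum>(a, b)\<in>P. b - a) < \<delta>
        \<longrightarrow> (\<Sum>(a, b)\<in>P. norm (f b - f a)) < \<epsilon>)"

definition ode_solution_on ::
    "('a::euclidean_space \<Rightarrow> 'a) \<Rightarrow> real \<Rightarrow> (real \<Rightarrow> 'a) \<Rightarrow> bool" where
  "ode_solution_on F T x \<longleftrightarrow>
     T > 0 \<and> absolutely_continuous_fun_on {0..T} x \<and>
     (AE t in lebesgue. t \<in> {0..T} \<longrightarrow> (x has_vector_derivative F (x t)) (at t within {0..T}))"

text \<open>Only the values on \<open>{0..}\<close> of a complete solution matter.\<close>

definition complete_solution ::
    "('a::euclidean_space \<Rightarrow> 'a) \<Rightarrow> (real \<Rightarrow> 'a) \<Rightarrow> bool" where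
  "complete_solution F x \<longleftrightarrow> (\<forall>T>0. ode_solution_on F T x)"

text \<open>Nonemptiness is required because \<open>infdist x {} = 0\<close> in the library, whereas the distance to
  the empty set is conventionally infinite.\<close>

definition converges_to_set :: "(real \<Rightarrow> 'a::euclidean_space) \<Rightarrow> 'a set \<Rightarrow> bool" where
  "converges_to_set y A \<longleftrightarrow> A \<noteq> {} \<and> ((\<lambda>t. infdist (y t) A) \<longlongrightarrow> 0) at_top"

definition projected_field ::
    "('a::euclidean_space \<Rightarrow> real) \<Rightarrow> 'a set \<Rightarrow> real \<Rightarrow> 'a \<Rightarrow> 'a" where
  "projected_field \<Phi> C K x =
     - gradient \<Phi> (closest_point C x) - (1 / K) *\<^sub>R (x - closest_point C x)"

end

theory Submission
  imports Defs "HOL-Complex_Analysis.Great_Picard"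
begin

text \<open>Let \<open>x\<close> be a solution, \<open>p = P x\<close> its projection and \<open>e = x - p\<close> the residual. Since \<open>e\<close> is normal
  to \<open>C\<close>, it is orthogonal to the velocity of \<open>p\<close>, and monotonicity of the projection gives
  \<open>d\<Phi>(p)/dt \<le> - \<bar>dp/dt\<bar>\<^sup>2\<close>. Hence \<open>p\<close> stays in a compact sublevel set and \<open>e\<close>, which decays at rate
  \<open>1/K\<close> up to a bounded forcing term, stays bounded. These a priori bounds turn Peano's theorem for a
  truncated field into global existence. As \<open>\<Phi>(p)\<close> converges, \<open>p\<close> moves by an arbitrarily small amount
  over late time windows of any fixed length. If a limit point \<open>q\<close> of \<open>p\<close> were not critical, some \<open>v\<close> in
  \<open>C\<close> would have \<open>- \<nabla>\<Phi>(q) \<bullet> (v - q) > 0\<close>; because \<open>e \<bullet> (v - p) \<le> 0\<close>, the quantity \<open>x \<bullet> (v - q)\<close>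
  would then grow at a definite rate over such a window, contradicting boundedness of \<open>x\<close>.\<close>

subsection \<open>Absolutely continuous functions\<close>

lemma absolutely_continuous_fun_on_subset:
  assumes "absolutely_continuous_fun_on S f" "T \<subseteq> S"
  shows "absolutely_continuous_fun_on T f"
  unfolding absolutely_continuous_fun_on_def
proof (intro allI impI)
  fix e :: real assume "e > 0"
  then obtain d where "d > 0" and d: "\<And>P. finite P \<and> (\<forall>(a, b)\<in>P. a \<le> b \<and> {a..b} \<subseteq> S) \<and>
        disjoint_family_on (\<lambda>(a, b). {a<..<b}) P \<and> (\<Sum>(a, b)\<in>P. b - a) < d
        \<Longrightarrow> (\<Sum>(a, b)\<in>P. norm (f b - f a)) < e"
    using assms(1) unfolding absolutely_continuous_fun_on_def by meson
  show "\<exists>d>0. \<forall>P. finite P \<and> (\<forall>(a, b)\<in>P. a \<le> b \<and> {a..b} \<subseteq> T) \<and>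
        disjoint_family_on (\<lambda>(a, b). {a<..<b}) P \<and> (\<Sum>(a, b)\<in>P. b - a) < d
        \<longrightarrow> (\<Sum>(a, b)\<in>P. norm (f b - f a)) < e"
    using \<open>d > 0\<close> \<open>T \<subseteq> S\<close> by (intro exI[of _ d] conjI allI impI d) (auto, fastforce)
qed

lemma absolutely_continuous_fun_on_diff:
  assumes "absolutely_continuous_fun_on S f" "absolutely_continuous_fun_on S g"
  shows "absolutely_continuous_fun_on S (\<lambda>t. f t - g t)"
  unfolding absolutely_continuous_fun_on_def
proof (intro allI impI)
  fix e :: real assume "e > 0"
  then have "e/2 > 0" by simp
  obtain d where "d > 0" and d: "\<And>P. finite P \<and> (\<forall>(a, b)\<in>P. a \<le> b \<and> {a..b} \<subseteq> S) \<and>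
        disjoint_family_on (\<lambda>(a, b). {a<..<b}) P \<and> (\<Sum>(a, b)\<in>P. b - a) < d
        \<Longrightarrow> (\<Sum>(a, b)\<in>P. norm (f b - f a)) < e/2"
    using assms(1) \<open>e/2 > 0\<close> unfolding absolutely_continuous_fun_on_def by meson
  obtain d' where "d' > 0" and d': "\<And>P. finite P \<and> (\<forall>(a, b)\<in>P. a \<le> b \<and> {a..b} \<subseteq> S) \<and>
        disjoint_family_on (\<lambda>(a, b). {a<..<b}) P \<and> (\<Sum>(a, b)\<in>P. b - a) < d'
        \<Longrightarrow> (\<Sum>(a, b)\<in>P. norm (g b - g a)) < e/2"
    using assms(2) \<open>e/2 > 0\<close> unfolding absolutely_continuous_fun_on_def by meson
  show "\<exists>d>0. \<forall>P. finite P \<and> (\<forall>(a, b)\<in>P. a \<le> b \<and> {a..b} \<subseteq> S) \<and>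
        disjoint_family_on (\<lambda>(a, b). {a<..<b}) P \<and> (\<Sum>(a, b)\<in>P. b - a) < d
        \<longrightarrow> (\<Sum>(a, b)\<in>P. norm (f b - g b - (f a - g a))) < e"
  proof (intro exI[of _ "min d d'"] conjI allI impI)
    show "min d d' > 0" using \<open>d > 0\<close> \<open>d' > 0\<close> by simp
    fix P :: "(real \<times> real) set"
    assume P: "finite P \<and> (\<forall>(a, b)\<in>P. a \<le> b \<and> {a..b} \<subseteq> S) \<and>
        disjoint_family_on (\<lambda>(a, b). {a<..<b}) P \<and> (\<Sum>(a, b)\<in>P. b - a) < min d d'"
    have "(\<Sum>(a, b)\<in>P. norm (f b - g b - (f a - g a)))
        \<le> (\<Sum>(a, b)\<in>P. norm (f b - f a) + norm (g b - g a))"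
    proof (rule sum_mono, clarsimp)
      fix a b
      have "f b - g b - (f a - g a) = (f b - f a) - (g b - g a)" by simp
      then show "norm (f b - g b - (f a - g a)) \<le> norm (f b - f a) + norm (g b - g a)"
        by (metis norm_triangle_ineq4)
    qed
    also have "\<dots> = (\<Sum>(a, b)\<in>P. norm (f b - f a)) + (\<Sum>(a, b)\<in>P. norm (g b - g a))"
      by (simp add: sum.distrib case_prod_unfold)
    also have "\<dots> < e/2 + e/2"
      by (intro add_strict_mono d d') (use P in auto)
    finally show "(\<Sum>(a, b)\<in>P. norm (f b - g b - (f a - g a))) < e" by simp
  qed
qed

lemma lipschitz_on_imp_absolutely_continuous_fun_on:
  assumes "L-lipschitz_on S f"
  shows "absolutely_continuous_fun_on S f"
  unfolding absolutely_continuous_fun_on_def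
proof (intro allI impI)
  fix e :: real assume "e > 0"
  have "L \<ge> 0" using assms by (rule lipschitz_on_nonneg)
  show "\<exists>d>0. \<forall>P. finite P \<and> (\<forall>(a, b)\<in>P. a \<le> b \<and> {a..b} \<subseteq> S) \<and>
        disjoint_family_on (\<lambda>(a, b). {a<..<b}) P \<and> (\<Sum>(a, b)\<in>P. b - a) < d
        \<longrightarrow> (\<Sum>(a, b)\<in>P. norm (f b - f a)) < e"
  \<comment> \<open>Dividing by \<open>L + 1\<close> rather than \<open>L\<close> covers the case of
    Lipschitz constant zero.\<close>
  proof (intro exI[of _ "e / (L+1)"] conjI allI impI)
    show "e / (L+1) > 0" using \<open>L \<ge> 0\<close> \<open>e > 0\<close> by simp
    fix P :: "(real \<times> real) set"
    assume P: "finite P \<and> (\<forall>(a, b)\<in>P. a \<le> b \<and> {a..b} \<subseteq> S) \<and>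
        disjoint_family_on (\<lambda>(a, b). {a<..<b}) P \<and> (\<Sum>(a, b)\<in>P. b - a) < e / (L+1)"
    have "(\<Sum>(a, b)\<in>P. norm (f b - f a)) \<le> (\<Sum>(a, b)\<in>P. (L+1) * (b - a))"
    proof (rule sum_mono, clarify)
      fix a b assume "(a, b) \<in> P"
      then have "a \<le> b" "a \<in> S" "b \<in> S" using P by fastforce+
      then have "norm (f b - f a) \<le> L * (b - a)"
        using lipschitz_onD[OF assms, of b a] by (simp add: dist_norm)
      also have "\<dots> \<le> (L+1) * (b - a)" using \<open>a \<le> b\<close> by (intro mult_right_mono) auto
      finally show "norm (f b - f a) \<le> (L+1) * (b - a)" .
    qed
    also have "\<dots> = (L+1) * (\<Sum>(a, b)\<in>P. b - a)"
      by (simp add: sum_distrib_left case_prod_unfold)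
    also have "\<dots> < (L+1) * (e / (L+1))"
      using P \<open>L \<ge> 0\<close> by (intro mult_strict_left_mono) auto
    finally show "(\<Sum>(a, b)\<in>P. norm (f b - f a)) < e" using \<open>L \<ge> 0\<close> by simp
  qed
qed

lemma absolutely_continuous_fun_on_imp_continuous_on:
  assumes "absolutely_continuous_fun_on {a..b} f"
  shows "continuous_on {a..b} f"
  unfolding continuous_on_iff
proof (intro ballI allI impI)
  fix t and e :: real assume t: "t \<in> {a..b}" and "e > 0"
  then obtain d where "d > 0" and d: "\<And>P. finite P \<and> (\<forall>(u, v)\<in>P. u \<le> v \<and> {u..v} \<subseteq> {a..b}) \<and>
        disjoint_family_on (\<lambda>(u, v). {u<..<v}) P \<and> (\<Sum>(u, v)\<in>P. v - u) < d
        \<Longrightarrow> (\<Sum>(u, v)\<in>P. norm (f v - f u)) < e"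
    using assms unfolding absolutely_continuous_fun_on_def by meson
  have *: "norm (f v - f u) < e" if "u \<in> {a..b}" "v \<in> {a..b}" "u \<le> v" "v - u < d" for u v
    using d[of "{(u, v)}"] that by (auto simp: disjoint_family_on_def)
  show "\<exists>d>0. \<forall>s\<in>{a..b}. dist s t < d \<longrightarrow> dist (f s) (f t) < e"
  proof (intro exI[of _ d] conjI ballI impI \<open>d > 0\<close>)
    fix s assume "s \<in> {a..b}" "dist s t < d"
    then show "dist (f s) (f t) < e"
      using *[of s t] *[of t s] t
      by (cases "s \<le> t") (auto simp: dist_norm norm_minus_commute)
  qed
qed

text \<open>Cousin's argument: take a tagged division fine for a gauge that controls the increments of \<open>f\<close>
  at tags outside \<open>N\<close> and keeps the intervals with tags in \<open>N\<close> inside an open set of small measure,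
  where absolute continuity applies.\<close>

lemma absolutely_continuous_fun_on_zero_derivative:
  fixes f :: "real \<Rightarrow> 'a::euclidean_space"
  assumes "a \<le> b" and ac: "absolutely_continuous_fun_on {a..b} f" and N: "negligible N"
    and der: "\<And>t. t \<in> {a..b} - N \<Longrightarrow> (f has_vector_derivative 0) (at t within {a..b})"
  shows "f b = f a"
proof -
  have bound: "norm (f b - f a) \<le> e * (1 + (b - a))" if "e > 0" for e :: real
  proof -
    obtain \<delta> where "\<delta> > 0" and \<delta>: "\<And>P. finite P \<and> (\<forall>(u, v)\<in>P. u \<le> v \<and> {u..v} \<subseteq> {a..b}) \<and>
        disjoint_family_on (\<lambda>(u, v). {u<..<v}) P \<and> (\<Sum>(u, v)\<in>P. v - u) < \<delta>
        \<Longrightarrow> (\<Sum>(u, v)\<in>P. norm (f v - f u)) < e"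
      using ac \<open>e > 0\<close> unfolding absolutely_continuous_fun_on_def by meson
    \<comment> \<open>Outer regularity of Lebesgue measure: \<open>N\<close> has measure zero, so an
      open superset can be taken with measure below the threshold of absolute continuity.\<close>
    obtain G where G: "open G" "N \<subseteq> G" "G \<in> lmeasurable" "measure lebesgue G < \<delta>"
    proof -
      obtain G where G: "open G" "N \<subseteq> G" "G - N \<in> lmeasurable" "emeasure lebesgue (G - N) < ennreal \<delta>"
        using sets_lebesgue_outer_open[OF negligible_imp_sets[OF N] \<open>\<delta> > 0\<close>] by blast
      have eq: "G = (G - N) \<union> N" using G(2) by blast
      have "G \<in> lmeasurable"
        using G(3) negligible_imp_measurable[OF N] by (subst eq) (rule fmeasurable.Un)
      moreover have "measure lebesgue G = measure lebesgue (G - N)"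
        by (rule measure_negligible_symdiff[symmetric])
           (use G(3) \<open>G \<in> lmeasurable\<close> in \<open>auto intro: negligible_subset[OF N]\<close>)
      moreover have "measure lebesgue (G - N) < \<delta>"
        using G(3,4) \<open>\<delta> > 0\<close> by (simp add: emeasure_eq_measure2 ennreal_less_iff)
      ultimately show thesis using G that by auto
    qed
    \<comment> \<open>Both demands on the gauge are packed into one predicate, so that a single
      choice of radii serves good and bad tags alike.\<close>
    define Q where "Q = (\<lambda>t d. (t \<in> N \<longrightarrow> ball t d \<subseteq> G) \<and> (t \<in> {a..b} - N \<longrightarrow>
        (\<forall>s\<in>{a..b}. norm (s - t) < d \<longrightarrow> norm (f s - f t) \<le> e * norm (s - t))))"
    have "\<exists>d>0. Q t d" for t
    proof (cases "t \<in> N")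
      case True
      then obtain d where "d > 0" "ball t d \<subseteq> G"
        using G(1,2) openE[of G t] by blast
      then show ?thesis using True by (auto simp: Q_def)
    next
      case False
      show ?thesis
      proof (cases "t \<in> {a..b}")
        case True
        with False der[of t] have "(f has_derivative (\<lambda>h. 0)) (at t within {a..b})"
          by (simp add: has_vector_derivative_def)
        then show ?thesis
          using False \<open>e > 0\<close> unfolding has_derivative_within_alt Q_def by auto
      qed (use False in \<open>auto simp: Q_def intro: exI[of _ 1]\<close>)
    qed
    then obtain d where d0: "\<And>t. d t > 0" and Q: "\<And>t. Q t (d t)"
      by metis
    have dN: "ball t (d t) \<subseteq> G" if "t \<in> N" for t
      using Q[of t] that by (simp add: Q_def)
    have d: "norm (f s - f t) \<le> e * norm (s - t)"
      if "t \<notin> N" "t \<in> {a..b}" "s \<in> {a..b}" "norm (s - t) < d t" for t s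
      using Q[of t] that by (simp add: Q_def)
    have "gauge (\<lambda>t. ball t (d t))" using d0 by (auto simp: gauge_def)
    then obtain p where p: "p tagged_division_of {a..b}" "(\<lambda>t. ball t (d t)) fine p"
      by (rule fine_division_exists_real)
    note pD = tagged_division_ofD[OF p(1)]
    have KI: "K = {Inf K..Sup K}"
      and K: "Inf K \<le> t" "t \<le> Sup K" "a \<le> Inf K" "Sup K \<le> b" "{Inf K..Sup K} \<subseteq> ball t (d t)"
      if tK: "(t, K) \<in> p" for t K
    proof -
      obtain u v where uv: "K = {u..v}" using pD(4)[OF tK] unfolding box_real by blast
      have t: "t \<in> K" "K \<subseteq> {a..b}" "K \<subseteq> ball t (d t)"
        using pD(2,3)[OF tK] p(2) tK by (auto simp: fine_def)
      then have "Inf K = u" "Sup K = v" using uv by auto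
      then show "K = {Inf K..Sup K}" "Inf K \<le> t" "t \<le> Sup K" "a \<le> Inf K" "Sup K \<le> b"
        "{Inf K..Sup K} \<subseteq> ball t (d t)"
        using uv t by auto
    qed
    have K': "Inf K \<le> Sup K" if "(t, K) \<in> p" for t K
      using K(1,2)[OF that] by linarith
    define h where "h = (\<lambda>(t::real, K). norm (f (Sup K) - f (Inf K)))"
    \<comment> \<open>Degenerate intervals are dropped here: their increments vanish, and the
      nonempty interiors of the others yield injectivity of \<open>\<phi>\<close> below.\<close>
    define q where "q = {(t, K). (t, K) \<in> p \<and> t \<in> N \<and> Inf K < Sup K}"
    define r where "r = {(t, K). (t, K) \<in> p \<and> t \<notin> N}"
    have fin: "finite p" "finite q" "finite r"
      using pD(1) by (auto simp: q_def r_def intro: finite_subset[of _ p])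
    have "norm (f b - f a) = norm (\<Sum>(t, K)\<in>p. f (Sup K) - f (Inf K))"
      using additive_tagged_division_1[OF \<open>a \<le> b\<close> p(1), of f] by simp
    also have "\<dots> \<le> sum h p"
      unfolding h_def by (rule order_trans[OF norm_sum]) (simp add: case_prod_unfold)
    also have "sum h p = sum h (q \<union> r)"
    proof (rule sum.mono_neutral_right)
      have "Inf (snd i) = Sup (snd i)" if "i \<in> p - (q \<union> r)" for i
        using that K'[of "fst i" "snd i"] by (auto simp: q_def r_def)
      then show "\<forall>i\<in>p - (q \<union> r). h i = 0"
        by (simp add: h_def case_prod_unfold)
    qed (use fin in \<open>auto simp: q_def r_def\<close>)
    also have "\<dots> = sum h q + sum h r"
      by (rule sum.union_disjoint) (use fin in \<open>auto simp: q_def r_def\<close>)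
    also have "sum h r \<le> (\<Sum>(t, K)\<in>r. e * (Sup K - Inf K))"
    proof (rule sum_mono, clarify)
      fix t K assume tK: "(t, K) \<in> r"
      then have tp: "(t, K) \<in> p" "t \<notin> N" by (auto simp: r_def)
      note b = K[OF tp(1)]
      have "Inf K \<in> ball t (d t)" "Sup K \<in> ball t (d t)"
        using b(1,2) by (auto intro!: subsetD[OF b(5)] simp del: mem_ball)
      then have "norm (f (Inf K) - f t) \<le> e * norm (Inf K - t)" "norm (f (Sup K) - f t) \<le> e * norm (Sup K - t)"
        using d[of t "Inf K"] d[of t "Sup K"] b(1-4) tp(2)
        by (auto simp: dist_norm norm_minus_commute)
      then have "norm (f (Inf K) - f t) \<le> e * (t - Inf K)" "norm (f (Sup K) - f t) \<le> e * (Sup K - t)"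
        using b(1,2) by simp_all
      then show "h (t, K) \<le> e * (Sup K - Inf K)"
        using norm_triangle_ineq4[of "f (Sup K) - f t" "f (Inf K) - f t"]
        by (simp add: h_def algebra_simps)
    qed
    also have "(\<Sum>(t, K)\<in>r. e * (Sup K - Inf K)) \<le> (\<Sum>(t, K)\<in>p. e * (Sup K - Inf K))"
    proof (rule sum_mono2[OF fin(1)])
      show "0 \<le> (case i of (t, K) \<Rightarrow> e * (Sup K - Inf K))" if "i \<in> p - r" for i
        using that K'[of "fst i" "snd i"] \<open>e > 0\<close> by (simp add: case_prod_unfold)
    qed (auto simp: r_def)
    also have "\<dots> = e * (b - a)"
      using additive_tagged_division_1[OF \<open>a \<le> b\<close> p(1), of "\<lambda>t. e * t"]
      by (simp add: right_diff_distrib)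
    also have "sum h q \<le> e"
    proof -
      define \<phi> where "\<phi> = (\<lambda>(t::real, K::real set). (Inf K, Sup K))"
      \<comment> \<open>The non-overlap of a tagged division, in a form that yields injectivity of
        \<open>\<phi>\<close> and disjointness of its image together.\<close>
      have qi: "i = j" if ij: "i \<in> q" "j \<in> q" "{fst (\<phi> i)<..<snd (\<phi> i)} \<inter> {fst (\<phi> j)<..<snd (\<phi> j)} \<noteq> {}" for i j
      proof (rule ccontr)
        assume "i \<noteq> j"
        obtain t K t' K' where eq: "i = (t, K)" "j = (t', K')" by (metis surj_pair)
        have "(t, K) \<in> p" "(t', K') \<in> p" using ij eq by (auto simp: q_def)
        then have "interior K \<inter> interior K' = {}" using pD(5) \<open>i \<noteq> j\<close> eq by blast
        moreover have "interior K = {Inf K<..<Sup K}" "interior K' = {Inf K'<..<Sup K'}"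
          using KI[OF \<open>(t, K) \<in> p\<close>] KI[OF \<open>(t', K') \<in> p\<close>] interior_atLeastAtMost_real by metis+
        ultimately show False using ij(3) eq by (simp add: \<phi>_def)
      qed
      have ne: "{fst (\<phi> i)<..<snd (\<phi> i)} \<noteq> {}" if "i \<in> q" for i
        using that by (auto simp: q_def \<phi>_def)
      have inj: "inj_on \<phi> q"
        by (rule inj_onI) (use qi ne in \<open>metis Int_absorb\<close>)
      have disj: "disjoint_family_on (\<lambda>(u, v). {u<..<v}) (\<phi> ` q)"
        unfolding disjoint_family_on_def case_prod_unfold using qi by blast
      \<comment> \<open>The total length is the measure of a disjoint union contained in
        \<open>G\<close>, hence below \<open>\<delta>\<close>, and absolute continuity applies to
        the whole family.\<close>
      have "(\<Sum>(u, v)\<in>\<phi> ` q. v - u) = (\<Sum>i\<in>\<phi> ` q. measure lebesgue {fst i<..<snd i})"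
        by (rule sum.cong) (auto simp: q_def \<phi>_def)
      also have "\<dots> = measure lebesgue (\<Union>i\<in>\<phi> ` q. {fst i<..<snd i})"
        by (rule measure_negligible_finite_Union_image[symmetric])
           (use fin disj in \<open>auto simp: pairwise_def disjoint_family_on_def case_prod_unfold\<close>)
      also have "\<dots> \<le> measure lebesgue G"
      proof (rule measure_mono_fmeasurable)
        show "(\<Union>i\<in>\<phi> ` q. {fst i<..<snd i}) \<subseteq> G"
        proof
          fix s assume "s \<in> (\<Union>i\<in>\<phi> ` q. {fst i<..<snd i})"
          then obtain t K where "(t, K) \<in> q" and s: "s \<in> {fst (\<phi> (t, K))<..<snd (\<phi> (t, K))}"
            by auto
          then have tK: "(t, K) \<in> p" "t \<in> N" by (auto simp: q_def)
          have "s \<in> {Inf K..Sup K}" using s by (simp add: \<phi>_def)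
          then have "s \<in> ball t (d t)" using K(5)[OF tK(1)] by blast
          then show "s \<in> G" using dN[OF tK(2)] by blast
        qed
        show "(\<Union>i\<in>\<phi> ` q. {fst i<..<snd i}) \<in> sets lebesgue"
          using fin by (intro sets.finite_UN) auto
      qed (rule G)
      finally have "(\<Sum>(u, v)\<in>\<phi> ` q. v - u) < \<delta>" using G by simp
      moreover have "\<forall>(u, v)\<in>\<phi> ` q. u \<le> v \<and> {u..v} \<subseteq> {a..b}"
      proof -
        have "fst (\<phi> i) \<le> snd (\<phi> i) \<and> {fst (\<phi> i)..snd (\<phi> i)} \<subseteq> {a..b}" if "i \<in> q" for i
          using that K'[of "fst i" "snd i"] K(3,4)[of "fst i" "snd i"] by (auto simp: q_def \<phi>_def)
        then show ?thesis by (simp add: case_prod_unfold)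
      qed
      ultimately have "(\<Sum>(u, v)\<in>\<phi> ` q. norm (f v - f u)) < e"
        using fin disj by (intro \<delta>) auto
      also have "(\<Sum>(u, v)\<in>\<phi> ` q. norm (f v - f u)) = sum h q"
        by (subst sum.reindex[OF inj]) (simp add: h_def \<phi>_def case_prod_unfold)
      finally show ?thesis by simp
    qed
    finally show ?thesis by (simp add: algebra_simps)
  qed
  have "norm (f b - f a) \<le> 0"
  proof (rule field_le_epsilon)
    fix e :: real assume "e > 0"
    then show "norm (f b - f a) \<le> 0 + e"
      using bound[of "e / (1 + (b - a))"] \<open>a \<le> b\<close> by simp
  qed
  then show ?thesis by simp
qed

text \<open>A continuous derivative is bounded on a compact interval, so the mean value inequality
  makes \<open>f\<close> Lipschitz.\<close>

lemma continuous_derivative_imp_absolutely_continuous_fun_on: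
  fixes f :: "real \<Rightarrow> 'a::euclidean_space"
  assumes der: "\<And>t. t \<in> {a..b} \<Longrightarrow> (f has_vector_derivative f' t) (at t within {a..b})"
    and cont: "continuous_on {a..b} f'"
  shows "absolutely_continuous_fun_on {a..b} f"
proof -
  have "bounded (f' ` {a..b})"
    using cont by (intro compact_imp_bounded compact_continuous_image) auto
  then obtain B where "B > 0" and B: "\<And>t. t \<in> {a..b} \<Longrightarrow> norm (f' t) \<le> B"
    unfolding bounded_pos by auto
  have "B-lipschitz_on {a..b} f"
  proof (rule lipschitz_onI)
    fix s t assume "s \<in> {a..b}" "t \<in> {a..b}"
    then have "norm (f s - f t) \<le> B * norm (s - t)"
      using der B \<open>B > 0\<close>
      by (intro differentiable_bound[of "{a..b}" f "\<lambda>t h. h *\<^sub>R f' t"])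
         (auto simp: has_vector_derivative_def mult.commute[of B] intro!: onorm_bound mult_left_mono)
    then show "dist (f s) (f t) \<le> B * dist s t" by (simp add: dist_norm)
  qed (use \<open>B > 0\<close> in simp)
  then show ?thesis by (rule lipschitz_on_imp_absolutely_continuous_fun_on)
qed

section \<open>Almost-everywhere solutions versus classical solutions\<close>

lemma ode_solution_onI:
  assumes "T > 0" "continuous_on UNIV F"
    and der: "\<And>t. t \<in> {0..T} \<Longrightarrow> (x has_vector_derivative F (x t)) (at t within {0..T})"
  shows "ode_solution_on F T x"
proof -
  have "continuous_on {0..T} x"
    using der by (meson continuous_on_vector_derivative)
  then have "continuous_on {0..T} (\<lambda>t. F (x t))"
    using continuous_on_compose2[OF assms(2)] by blast
  then show ?thesis
    unfolding ode_solution_on_def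
    using assms(1) der continuous_derivative_imp_absolutely_continuous_fun_on[OF der] by simp
qed

text \<open>The difference between \<open>x\<close> and the indefinite integral of
  \<open>F (x t)\<close> is absolutely continuous with derivative zero off a null set, hence
  constant. The integral is differentiable everywhere because its integrand is continuous, and
  \<open>x\<close> inherits this. All later analysis can thus use classical derivatives.\<close>

lemma ode_solution_on_continuous_derivative:
  assumes "ode_solution_on F T x" "continuous_on UNIV F" "t \<in> {0..T}"
  shows "(x has_vector_derivative F (x t)) (at t within {0..T})"
proof -
  have ac: "absolutely_continuous_fun_on {0..T} x"
    and "AE t in lebesgue. t \<in> {0..T} \<longrightarrow> (x has_vector_derivative F (x t)) (at t within {0..T})"
    using assms(1) by (auto simp: ode_solution_on_def)
  then obtain N where N: "N \<in> null_sets lebesgue"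
    and derN: "{t. \<not> (t \<in> {0..T} \<longrightarrow> (x has_vector_derivative F (x t)) (at t within {0..T}))} \<subseteq> N"
    unfolding eventually_ae_filter by auto
  have cont: "continuous_on {0..T} (\<lambda>t. F (x t))"
    using absolutely_continuous_fun_on_imp_continuous_on[OF ac]
      continuous_on_compose2[OF assms(2)] by blast
  define g where "g = (\<lambda>t. integral {0..t} (\<lambda>s. F (x s)))"
  have g: "(g has_vector_derivative F (x t)) (at t within {0..T})" if "t \<in> {0..T}" for t
    unfolding g_def using integral_has_vector_derivative[OF cont that] .
  have ac': "absolutely_continuous_fun_on {0..T} (\<lambda>t. x t - g t)"
    by (intro absolutely_continuous_fun_on_diff ac
        continuous_derivative_imp_absolutely_continuous_fun_on[OF g cont])
  have "x s - g s = x 0 - g 0" if "s \<in> {0..T}" for s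
  proof (rule absolutely_continuous_fun_on_zero_derivative)
    show "absolutely_continuous_fun_on {0..s} (\<lambda>t. x t - g t)"
      using that by (intro absolutely_continuous_fun_on_subset[OF ac']) auto
    show "negligible N" using N by (simp add: negligible_iff_null_sets)
    fix t assume "t \<in> {0..s} - N"
    then have "((\<lambda>t. x t - g t) has_vector_derivative F (x t) - F (x t)) (at t within {0..T})"
      using derN that by (intro has_vector_derivative_diff g) auto
    then show "((\<lambda>t. x t - g t) has_vector_derivative 0) (at t within {0..s})"
      using that by (simp add: has_vector_derivative_within_subset[of _ _ _ "{0..T}"])
  qed (use that in auto)
  then have eq: "x s = g s + (x 0 - g 0)" if "s \<in> {0..T}" for s
    using that by (metis diff_add_cancel add.commute)
  have "((\<lambda>s. g s + (x 0 - g 0)) has_vector_derivative F (x t)) (at t within {0..T})"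
    using g[OF assms(3)] by (auto intro: derivative_eq_intros)
  then show ?thesis
    by (rule has_vector_derivative_transform[OF assms(3), rotated]) (rule eq)
qed

subsection \<open>Peano's existence theorem\<close>

text \<open>Tonelli's scheme: the equation with delay \<open>d\<close> is solved on \<open>[0, m d]\<close> by \<open>m\<close> Picard steps, since each
  step extends by \<open>d\<close> the interval on which the iterates have become stationary.\<close>

definition delay_step :: "('a::euclidean_space \<Rightarrow> 'a) \<Rightarrow> 'a \<Rightarrow> real \<Rightarrow> (real \<Rightarrow> 'a) \<Rightarrow> real \<Rightarrow> 'a" where
  "delay_step F x0 d \<phi> t = x0 + integral {0..t} (\<lambda>s. F (\<phi> (max 0 (s - d))))"

lemma continuous_on_delay:
  fixes F :: "'a::euclidean_space \<Rightarrow> 'a" and \<phi> :: "real \<Rightarrow> 'a"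
  assumes "continuous_on UNIV F" "continuous_on {0..} \<phi>"
  shows "continuous_on S (\<lambda>s. F (\<phi> (max 0 (s - d))))"
proof -
  have "continuous_on S (\<lambda>s. max 0 (s - d))"
    by (intro continuous_on_max continuous_intros)
  then have "continuous_on S (\<lambda>s. \<phi> (max 0 (s - d)))"
    by (rule continuous_on_compose2[OF assms(2)]) auto
  then show ?thesis
    by (rule continuous_on_compose2[OF assms(1)]) auto
qed

lemma delay_step_lipschitz:
  assumes cont: "continuous_on UNIV F" and M: "\<And>x. norm (F x) \<le> M"
    and \<phi>: "continuous_on {0..} \<phi>"
  shows "M-lipschitz_on {0..} (delay_step F x0 d \<phi>)"
proof (rule lipschitz_on_leI)
  show "M \<ge> 0" using M[of 0] norm_ge_zero order_trans by blast
  fix s t :: real assume st: "s \<in> {0..}" "t \<in> {0..}" "s \<le> t"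
  let ?f = "\<lambda>s. F (\<phi> (max 0 (s - d)))"
  have c: "continuous_on S ?f" for S by (rule continuous_on_delay[OF cont \<phi>])
  have "integral {0..s} ?f + integral {s..t} ?f = integral {0..t} ?f"
    using st by (intro Henstock_Kurzweil_Integration.integral_combine integrable_continuous_real c) auto
  then have "delay_step F x0 d \<phi> t - delay_step F x0 d \<phi> s = integral {s..t} ?f"
    by (simp add: delay_step_def algebra_simps)
  moreover have "norm (integral {s..t} ?f) \<le> M * (t - s)"
    using st by (intro integral_bound c M) auto
  ultimately show "dist (delay_step F x0 d \<phi> s) (delay_step F x0 d \<phi> t) \<le> M * dist s t"
    using st by (simp add: dist_norm norm_minus_commute[of "delay_step F x0 d \<phi> s"])
qed

text \<open>The constant depends on neither \<open>m\<close> nor \<open>d\<close>: this is the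
  equicontinuity needed to pass to the limit.\<close>

lemma delay_step_funpow_lipschitz:
  assumes "continuous_on UNIV F" and M: "\<And>x. norm (F x) \<le> M"
  shows "M-lipschitz_on {0..} ((delay_step F x0 d ^^ m) (\<lambda>_. x0))"
proof (induction m)
  case 0
  have "M \<ge> 0" using M[of 0] norm_ge_zero order_trans by blast
  then show ?case by (simp add: lipschitz_on_def)
next
  case (Suc m)
  then show ?case
    using delay_step_lipschitz[OF assms lipschitz_on_continuous_on[OF Suc]] by simp
qed

text \<open>The value of a step at \<open>t\<close> reads its argument only at times up to
  \<open>max 0 (t - d)\<close>. If two successive iterates agree on \<open>[0, m d]\<close>, the
  next two therefore agree on \<open>[0, (m + 1) d]\<close>; the induction starts from an integral
  over a single point.\<close>

lemma delay_step_funpow_fixed: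
  assumes "d > 0" "0 \<le> t" "t \<le> real m * d"
  shows "delay_step F x0 d ((delay_step F x0 d ^^ m) (\<lambda>_. x0)) t = (delay_step F x0 d ^^ m) (\<lambda>_. x0) t"
  using assms(2,3)
proof (induction m arbitrary: t)
  case 0
  then show ?case by (simp add: delay_step_def)
next
  case (Suc m)
  let ?X = "\<lambda>m. (delay_step F x0 d ^^ m) (\<lambda>_. x0)"
  have "integral {0..t} (\<lambda>s. F (?X (Suc m) (max 0 (s - d)))) = integral {0..t} (\<lambda>s. F (?X m (max 0 (s - d))))"
  proof (rule integral_cong)
    fix s assume "s \<in> {0..t}"
    then have "max 0 (s - d) \<le> real m * d"
      using Suc.prems \<open>d > 0\<close> by (auto simp: algebra_simps)
    then show "F (?X (Suc m) (max 0 (s - d))) = F (?X m (max 0 (s - d)))"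
      using Suc.IH[of "max 0 (s - d)"] by simp
  qed
  then have "delay_step F x0 d (?X (Suc m)) t = delay_step F x0 d (?X m) t"
    unfolding delay_step_def[of F x0 d _ t] by simp
  then show ?case by simp
qed

lemma Tonelli_approximation:
  fixes F :: "'a::euclidean_space \<Rightarrow> 'a"
  assumes "continuous_on UNIV F" and "\<And>x. norm (F x) \<le> M"
  obtains X :: "nat \<Rightarrow> real \<Rightarrow> 'a" where
    "\<And>n. M-lipschitz_on {0..} (X n)" "\<And>n. X n 0 = x0"
    "\<And>n t. 0 \<le> t \<Longrightarrow> t \<le> real (Suc n) \<Longrightarrow>
       X n t = x0 + integral {0..t} (\<lambda>s. F (X n (max 0 (s - 1 / real (Suc n)))))"
proof
  \<comment> \<open>With delay \<open>1 / Suc n\<close>, \<open>(Suc n)\<^sup>2\<close> steps make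
    the iterate stationary up to time \<open>Suc n\<close>: the delay shrinks while the interval of
    validity grows.\<close>
  let ?X = "\<lambda>n::nat. (delay_step F x0 (1 / real (Suc n)) ^^ (Suc n)\<^sup>2) (\<lambda>_. x0)"
  show "M-lipschitz_on {0..} (?X n)" for n
    by (rule delay_step_funpow_lipschitz[OF assms])
  show *: "?X n t = x0 + integral {0..t} (\<lambda>s. F (?X n (max 0 (s - 1 / real (Suc n)))))"
    if "0 \<le> t" "t \<le> real (Suc n)" for n t
  proof -
    have "real ((Suc n)\<^sup>2) * (1 / real (Suc n)) = real (Suc n)"
      by (simp only: power2_eq_square of_nat_mult) simp
    then have "delay_step F x0 (1 / real (Suc n)) (?X n) t = ?X n t"
      using that by (intro delay_step_funpow_fixed) (auto simp del: of_nat_Suc)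
    then show ?thesis
      unfolding delay_step_def[of F x0 _ "?X n"] by (rule sym)
  qed
  show "?X n 0 = x0" for n
    using *[of 0 n] by simp
qed

text \<open>The subsequence theorem needs a uniform bound on all of \<open>[0, \<infinity>)\<close>, hence the weight \<open>1 / (1 + t)\<close>.\<close>

lemma lipschitz_pointwise_convergent_subsequence:
  fixes X :: "nat \<Rightarrow> real \<Rightarrow> 'a::euclidean_space"
  assumes lip: "\<And>n. M-lipschitz_on {0..} (X n)" and X0: "\<And>n. X n 0 = x0"
  obtains k x where "strict_mono (k::nat \<Rightarrow> nat)" "\<And>t. 0 \<le> t \<Longrightarrow> (\<lambda>n. X (k n) t) \<longlonglongrightarrow> x t"
proof -
  have M: "M \<ge> 0" using lip lipschitz_on_nonneg by blast
  have "norm (X n t /\<^sub>R (1 + t)) \<le> norm x0 + M" if "t \<in> \<rat> \<inter> {0..}" for n t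
  proof -
    have "norm (X n t - x0) \<le> M * t"
      using lipschitz_onD[OF lip, of t 0 n] that X0 by (simp add: dist_norm)
    then have "norm (X n t) \<le> norm x0 + M * t"
      using norm_triangle_sub[of "X n t" x0] by simp
    also have "\<dots> \<le> (norm x0 + M) * (1 + t)"
      using that M by (simp add: algebra_simps)
    finally show ?thesis using that by (simp add: field_simps)
  qed
  then obtain k where k: "strict_mono (k::nat \<Rightarrow> nat)"
    and conv: "\<And>t. t \<in> \<rat> \<inter> {0..} \<Longrightarrow> \<exists>l. (\<lambda>n. X (k n) t /\<^sub>R (1 + t)) \<longlonglongrightarrow> l"
    using function_convergent_subsequence[of "\<rat> \<inter> {0..}" "\<lambda>n t. X n t /\<^sub>R (1 + t)"]
      countable_rat by (metis countable_Int1)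
  have "convergent (\<lambda>n. X (k n) t)" if "t \<ge> 0" for t
    unfolding Cauchy_convergent_iff[symmetric]
  proof (rule metric_CauchyI)
    fix e :: real assume "e > 0"
    \<comment> \<open>A nearby rational time \<open>q\<close> carries the Cauchy property over to
      \<open>t\<close>: within distance \<open>d\<close>, the common Lipschitz bound costs less than
      \<open>e/3\<close> on each side.\<close>
    define d where "d = e / (3 * (M + 1))"
    have "d > 0" using \<open>e > 0\<close> M by (simp add: d_def)
    then obtain q where q: "q \<in> \<rat>" "t < q" "q < t + d"
      using Rats_dense_in_real[of t "t + d"] by auto
    have "\<exists>l. (\<lambda>n. X (k n) q /\<^sub>R (1 + q)) \<longlonglongrightarrow> l" using conv q that by auto
    then obtain l where "(\<lambda>n. X (k n) q /\<^sub>R (1 + q)) \<longlonglongrightarrow> l" by blast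
    then have "(\<lambda>n. (1 + q) *\<^sub>R (X (k n) q /\<^sub>R (1 + q))) \<longlonglongrightarrow> (1 + q) *\<^sub>R l"
      by (intro tendsto_intros)
    then have "Cauchy (\<lambda>n. X (k n) q)"
      using q that by (intro LIMSEQ_imp_Cauchy) simp
    then obtain N where N: "\<And>m n. m \<ge> N \<Longrightarrow> n \<ge> N \<Longrightarrow> dist (X (k m) q) (X (k n) q) < e/3"
      using \<open>e > 0\<close> unfolding Cauchy_def by (metis divide_pos_pos zero_less_numeral)
    have close: "dist (X n t) (X n q) < e/3" for n
    proof -
      have "dist (X n t) (X n q) \<le> M * (q - t)"
        using lipschitz_onD[OF lip, of t q n] q that by (simp add: dist_real_def)
      also have "\<dots> \<le> (M + 1) * (q - t)" using q by (intro mult_right_mono) auto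
      also have "\<dots> < (M + 1) * d" using q M by (intro mult_strict_left_mono) auto
      also have "\<dots> = e/3" using M by (simp add: d_def field_simps)
      finally show ?thesis .
    qed
    show "\<exists>N. \<forall>m\<ge>N. \<forall>n\<ge>N. dist (X (k m) t) (X (k n) t) < e"
    proof (intro exI[of _ N] allI impI)
      fix m n assume "m \<ge> N" "n \<ge> N"
      then show "dist (X (k m) t) (X (k n) t) < e"
        using N[of m n] close[of "k m"] close[of "k n"]
          dist_triangle[of "X (k m) t" "X (k n) t" "X (k m) q"]
          dist_triangle[of "X (k m) q" "X (k n) t" "X (k n) q"]
        by (simp add: dist_commute)
    qed
  qed
  then have "(\<lambda>n. X (k n) t) \<longlonglongrightarrow> lim (\<lambda>n. X (k n) t)" if "t \<ge> 0" for t
    using that by (simp add: convergent_LIMSEQ_iff)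
  with k show thesis by (rule that)
qed

text \<open>A subsequence of the Tonelli approximations converges pointwise, and dominated
  convergence with the constant bound \<open>M\<close> passes the delayed integral equation to the
  limit. The fundamental theorem of calculus then returns the differential equation.\<close>

theorem Peano_existence:
  fixes F :: "'a::euclidean_space \<Rightarrow> 'a"
  assumes cont: "continuous_on UNIV F" and M: "\<And>x. norm (F x) \<le> M"
  shows "\<exists>x. x 0 = x0 \<and> (\<forall>T. \<forall>t\<in>{0..T}. (x has_vector_derivative F (x t)) (at t within {0..T}))"
proof -
  obtain X where lip: "\<And>n. M-lipschitz_on {0..} (X n)" and X0: "\<And>n. X n 0 = x0"
    and X: "\<And>n t. 0 \<le> t \<Longrightarrow> t \<le> real (Suc n) \<Longrightarrow>
       X n t = x0 + integral {0..t} (\<lambda>s. F (X n (max 0 (s - 1 / real (Suc n)))))"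
  proof (rule Tonelli_approximation[OF cont M, of x0], goal_cases)
    case (1 X)
    show ?case by (rule 1(1)[OF 1(2-4)])
  qed
  obtain k x where k: "strict_mono (k::nat \<Rightarrow> nat)" and x: "\<And>t. 0 \<le> t \<Longrightarrow> (\<lambda>n. X (k n) t) \<longlonglongrightarrow> x t"
  proof (rule lipschitz_pointwise_convergent_subsequence[of M X x0, OF lip X0], goal_cases)
    case (1 k x)
    show ?case by (rule 1(1)[OF 1(2-3)])
  qed
  have M0: "M \<ge> 0" using lip lipschitz_on_nonneg by blast
  have k0: "(\<lambda>n. 1 / real (Suc (k n))) \<longlonglongrightarrow> 0"
    using LIMSEQ_subseq_LIMSEQ[OF LIMSEQ_Suc[OF lim_1_over_n] k] by (simp add: o_def)
  have lipx: "M-lipschitz_on {0..} x"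
  proof (rule lipschitz_onI)
    fix s t :: real assume "s \<in> {0..}" "t \<in> {0..}"
    then show "dist (x s) (x t) \<le> M * dist s t"
      using lipschitz_onD[OF lip]
      by (intro tendsto_upperbound[OF tendsto_dist[OF x x]]) auto
  qed (rule M0)
  have contx: "continuous_on S (\<lambda>t. F (x t))" if "S \<subseteq> {0..}" for S
    using continuous_on_compose2[OF cont] lipschitz_on_continuous_on[OF lipx]
      continuous_on_subset that by blast
  have eq: "x t = x0 + integral {0..t} (\<lambda>s. F (x s))" if "t \<ge> 0" for t
  proof (rule LIMSEQ_unique[OF x[OF that]])
    let ?f = "\<lambda>n s. F (X (k n) (max 0 (s - 1 / real (Suc (k n)))))"
    have "(\<lambda>n. integral {0..t} (?f n)) \<longlonglongrightarrow> integral {0..t} (\<lambda>s. F (x s))"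
    proof (rule dominated_convergence(2))
      show "?f n integrable_on {0..t}" for n
        by (intro integrable_continuous_real continuous_on_delay[OF cont] lipschitz_on_continuous_on[OF lip])
      show "(\<lambda>_. M) integrable_on {0..t}" by (rule integrable_const_ivl)
      show "norm (?f n s) \<le> M" for n s by (rule M)
      fix s assume s: "s \<in> {0..t}"
      \<comment> \<open>The delay disappears in the limit, since by the Lipschitz bound it displaces
        the value by at most \<open>M\<close> times its length.\<close>
      have "(\<lambda>n. X (k n) (max 0 (s - 1 / real (Suc (k n)))) - X (k n) s) \<longlonglongrightarrow> 0"
      proof (rule Lim_null_comparison)
        have "norm (X (k n) (max 0 (s - 1 / real (Suc (k n)))) - X (k n) s) \<le> M * (1 / real (Suc (k n)))" for n
        proof -
          have "norm (X (k n) (max 0 (s - 1 / real (Suc (k n)))) - X (k n) s)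
              \<le> M * dist (max 0 (s - 1 / real (Suc (k n)))) s"
            using lipschitz_onD[OF lip, of "max 0 (s - 1 / real (Suc (k n)))" s "k n"] s
            by (simp add: dist_norm)
          also have "dist (max 0 (s - 1 / real (Suc (k n)))) s \<le> 1 / real (Suc (k n))"
            using s by (auto simp: dist_real_def max_def)
          finally show ?thesis using M0 by (simp add: mult_left_mono)
        qed
        then show "\<forall>\<^sub>F n in sequentially. norm (X (k n) (max 0 (s - 1 / real (Suc (k n)))) - X (k n) s)
            \<le> M * (1 / real (Suc (k n)))" by simp
        show "(\<lambda>n. M * (1 / real (Suc (k n)))) \<longlonglongrightarrow> 0"
          using tendsto_mult_right_zero[OF k0] by blast
      qed
      then have "(\<lambda>n. X (k n) (max 0 (s - 1 / real (Suc (k n))))) \<longlonglongrightarrow> x s"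
        using Lim_transform x s by fastforce
      then show "(\<lambda>n. ?f n s) \<longlonglongrightarrow> F (x s)"
        by (rule continuous_on_tendsto_compose[OF cont]) auto
    qed
    then have "(\<lambda>n. x0 + integral {0..t} (?f n)) \<longlonglongrightarrow> x0 + integral {0..t} (\<lambda>s. F (x s))"
      by (intro tendsto_intros)
    \<comment> \<open>Each approximation satisfies its equation only up to \<open>Suc (k n)\<close>,
      which eventually exceeds \<open>t\<close>.\<close>
    moreover have "\<forall>\<^sub>F n in sequentially. x0 + integral {0..t} (?f n) = X (k n) t"
    proof -
      have "\<forall>\<^sub>F n in sequentially. t \<le> real n"
        by (metis eventually_sequentiallyI real_arch_simple of_nat_le_iff order_trans)
      then show ?thesis
      proof eventually_elim
        case (elim n)
        then have "t \<le> real (Suc (k n))" using seq_suble[OF k, of n] by simp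
        then show ?case using X[of t "k n"] that by simp
      qed
    qed
    ultimately show "(\<lambda>n. X (k n) t) \<longlonglongrightarrow> x0 + integral {0..t} (\<lambda>s. F (x s))"
      by (rule Lim_transform_eventually)
  qed
  show ?thesis
  proof (intro exI[of _ x] conjI allI ballI)
    show "x 0 = x0" using eq[of 0] by simp
    fix T t :: real assume t: "t \<in> {0..T}"
    have "((\<lambda>u. x0 + integral {0..u} (\<lambda>s. F (x s))) has_vector_derivative F (x t)) (at t within {0..T})"
      using integral_has_vector_derivative[OF contx t]
      by (auto intro: derivative_eq_intros)
    then show "(x has_vector_derivative F (x t)) (at t within {0..T})"
      using eq t has_vector_derivative_transform by (metis (no_types, lifting) atLeastAtMost_iff)
  qed
qed

subsection \<open>Energy dissipation and convergence\<close>

text \<open>For fixed slope \<open>e\<close>, the times at which \<open>f\<close> lies below the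
  line of slope \<open>e\<close> through its initial value form a closed set. At its supremum the
  Dini condition would allow a further step to the right, so the supremum is \<open>b\<close>; then
  \<open>e\<close> tends to zero. This replaces integration for functions that are merely
  continuous.\<close>

lemma right_Dini_nonpos_imp_le:
  fixes f :: "real \<Rightarrow> real"
  assumes "a \<le> b" and cont: "continuous_on {a..b} f"
    and Dini: "\<And>t e. a \<le> t \<Longrightarrow> t < b \<Longrightarrow> e > 0 \<Longrightarrow> \<forall>\<^sub>F u in at_right t. f u \<le> f t + e * (u - t)"
  shows "f b \<le> f a"
proof -
  have *: "f b \<le> f a + e * (b - a)" if "e > 0" for e
  proof -
    define S where "S = {t \<in> {a..b}. f t - e * t \<le> f a - e * a}"
    have "closed S"
      unfolding S_def by (intro continuous_on_closed_Collect_le cont continuous_intros closed_atLeastAtMost)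
    moreover have "S \<noteq> {}" "bdd_above S" using \<open>a \<le> b\<close> by (auto simp: S_def)
    ultimately have m: "Sup S \<in> S" by (simp add: closed_contains_Sup)
    have "\<not> Sup S < b"
    proof
      assume "Sup S < b"
      then obtain d where d: "d > Sup S" "\<And>u. Sup S < u \<Longrightarrow> u < d \<Longrightarrow> f u \<le> f (Sup S) + e * (u - Sup S)"
        using Dini[of "Sup S" e] m \<open>e > 0\<close> unfolding eventually_at_right_field S_def by auto
      obtain u where u: "Sup S < u" "u < min d b"
        using d(1) \<open>Sup S < b\<close> dense[of "Sup S" "min d b"] by auto
      then have "u \<in> S" using d(2)[of u] m by (auto simp: S_def algebra_simps)
      then show False using u \<open>bdd_above S\<close> cSup_upper by fastforce
    qed
    then have "Sup S = b" using m by (auto simp: S_def)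
    then show ?thesis using m by (simp add: S_def algebra_simps)
  qed
  show ?thesis
  proof (rule field_le_epsilon)
    fix e :: real assume "e > 0"
    then have "f b \<le> f a + e / (b - a + 1) * (b - a)" using \<open>a \<le> b\<close> by (intro *) auto
    also have "e / (b - a + 1) * (b - a) \<le> e" using \<open>e > 0\<close> \<open>a \<le> b\<close> by (simp add: field_simps)
    finally show "f b \<le> f a + e" by simp
  qed
qed

lemma has_vector_derivative_right_expansion:
  fixes x :: "real \<Rightarrow> 'a::real_normed_vector"
  assumes "(x has_vector_derivative v) (at t within {a..b})" "a \<le> t" "t < b" "e > 0"
  obtains d where "d > 0" "\<And>u. t < u \<Longrightarrow> u < t + d \<Longrightarrow> norm (x u - x t - (u - t) *\<^sub>R v) \<le> e * (u - t)"
proof -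
  obtain d where "d > 0" and d: "\<And>u. u \<in> {a..b} \<Longrightarrow> norm (u - t) < d \<Longrightarrow>
      norm (x u - x t - (u - t) *\<^sub>R v) \<le> e * norm (u - t)"
    using assms unfolding has_vector_derivative_def has_derivative_within_alt by blast
  show thesis
  proof (rule that[of "min d (b - t)"])
    show "min d (b - t) > 0" using \<open>d > 0\<close> assms by simp
    fix u assume "t < u" "u < t + min d (b - t)"
    then show "norm (x u - x t - (u - t) *\<^sub>R v) \<le> e * (u - t)"
      using d[of u] assms by auto
  qed
qed

section \<open>The system, its projection and its energy\<close>

locale projected_gradient_system =
  fixes C :: "'a::euclidean_space set" and \<Phi> :: "'a \<Rightarrow> real" and K :: real
  assumes nonempty: "C \<noteq> {}" and closed: "closed C" and convex: "convex C"
    and smooth: "continuously_differentiable_near \<Phi> C"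
    and sublevel: "\<And>l :: real. compact {x \<in> C. \<Phi> x \<le> l}"
    and K_pos: "K > 0"
begin

abbreviation "P \<equiv> closest_point C"
abbreviation "grad \<equiv> gradient \<Phi>"
abbreviation "F \<equiv> projected_field \<Phi> C K"

text \<open>Classical solutions on an arbitrary interval. The condition is vacuous for
  \<open>b < a\<close>, so quantifying over all \<open>T\<close> calls for no sign
  condition.\<close>

definition solves :: "real \<Rightarrow> real \<Rightarrow> (real \<Rightarrow> 'a) \<Rightarrow> bool" where
  "solves a b x \<longleftrightarrow> (\<forall>t\<in>{a..b}. (x has_vector_derivative F (x t)) (at t within {a..b}))"

lemma solves_subinterval: "solves a b x \<Longrightarrow> a \<le> c \<Longrightarrow> d \<le> b \<Longrightarrow> solves c d x"
  unfolding solves_def by (auto intro: has_vector_derivative_within_subset[of _ _ _ "{a..b}"])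

lemma solves_continuous_on: "solves a b x \<Longrightarrow> continuous_on {a..b} x"
  unfolding solves_def by (meson continuous_on_vector_derivative)

lemma P_in: "P x \<in> C"
  using closest_point_in_set[OF closed nonempty] .

lemma P_dot: "z \<in> C \<Longrightarrow> (x - P x) \<bullet> (z - P x) \<le> 0"
  using closest_point_dot[OF convex closed] .

lemma P_nonexpansive: "norm (P x - P y) \<le> norm (x - y)"
  using closest_point_lipschitz[OF convex closed nonempty] by (simp add: dist_norm)

lemma continuous_on_P: "continuous_on S P"
  using continuous_on_closest_point[OF convex closed nonempty] .

lemma continuous_on_grad: "continuous_on C grad"
  using smooth continuous_on_subset unfolding continuously_differentiable_near_def by blast

lemma has_derivative_objective: "z \<in> C \<Longrightarrow> (\<Phi> has_derivative (\<lambda>h. h \<bullet> grad z)) (at z)"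
  using smooth differentiable_GDERIV_gradient
  unfolding continuously_differentiable_near_def gderiv_def by blast

lemma continuous_on_objective: "continuous_on C \<Phi>"
  by (intro continuous_at_imp_continuous_on ballI has_derivative_continuous[OF has_derivative_objective])

lemma continuous_on_field: "continuous_on UNIV F"
  unfolding projected_field_def
  by (intro continuous_intros continuous_on_P continuous_on_compose2[OF continuous_on_grad continuous_on_P])
     (auto simp: P_in)

text \<open>Split \<open>y - x\<close> into the increment of the projection and that of the
  residual; the variational inequalities at \<open>x\<close> and at \<open>y\<close> fix the signs
  of the cross terms. The first claim is firm nonexpansiveness. The second bounds the pairing of the
  residual with the projected increment by a product of two increments, a second-order quantity:
  this stands in for orthogonality.\<close>

lemma projection_increment:
  shows "norm (P y - P x) ^ 2 \<le> (P y - P x) \<bullet> (y - x)"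
    and "- ((x - P x) \<bullet> (P y - P x)) \<le> norm (y - x) * norm (P y - P x)"
proof -
  have a: "(x - P x) \<bullet> (P y - P x) \<le> 0" by (rule P_dot[OF P_in])
  have b: "(y - P y) \<bullet> (P y - P x) \<ge> 0"
    using P_dot[OF P_in, of y x] by (simp add: inner_diff_right)
  have eq: "(P y - P x) \<bullet> (y - x)
      = norm (P y - P x) ^ 2 + (y - P y) \<bullet> (P y - P x) - (x - P x) \<bullet> (P y - P x)"
    unfolding power2_norm_eq_inner by (simp add: inner_diff_left inner_diff_right inner_commute)
  show "norm (P y - P x) ^ 2 \<le> (P y - P x) \<bullet> (y - x)" using a b eq by linarith
  have "- ((x - P x) \<bullet> (P y - P x)) \<le> (P y - P x) \<bullet> (y - x)"
    using b eq zero_le_power2[of "norm (P y - P x)"] by linarith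
  also have "\<dots> \<le> norm (y - x) * norm (P y - P x)"
    using norm_cauchy_schwarz[of "P y - P x" "y - x"] by (simp add: mult.commute)
  finally show "- ((x - P x) \<bullet> (P y - P x)) \<le> norm (y - x) * norm (P y - P x)" .
qed

text \<open>Linearised form of \<open>d\<Phi>(P x)/dt \<le> - \<bar>d(P x)/dt\<bar>\<^sup>2\<close>: by AM-GM, \<open>2 c \<bar>\<Delta>\<bar> \<le> c\<^sup>2 h + \<bar>\<Delta>\<bar>\<^sup>2 / h\<close>. In this form
  it integrates without differentiating \<open>P x\<close>, which is only Lipschitz.\<close>

lemma energy_right_Dini:
  assumes der: "(x has_vector_derivative F (x t)) (at t within {a..b})" and t: "a \<le> t" "t < b" and "e > 0"
  shows "\<forall>\<^sub>F u in at_right t. \<Phi> (P (x u)) - \<Phi> (P (x t)) + 2 * c * norm (P (x u) - P (x t))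
           \<le> (c\<^sup>2 + e) * (u - t)"
proof -
  define f where "f = F (x t)"
  define L where "L = norm f + 1"
  have L: "L \<ge> 1" by (simp add: L_def)
  \<comment> \<open>Error budget: \<open>\<delta> * L\<close> occurs twice, at \<open>e / 4\<close>
    each, and the residual term takes \<open>e / 2\<close> through the choice of \<open>d\<close>.
    The bound \<open>\<delta> \<le> 1\<close> keeps the increment of \<open>x\<close> below
    \<open>h * L\<close>.\<close>
  define \<delta> where "\<delta> = min 1 (e / (4 * L))"
  have \<delta>: "\<delta> > 0" "\<delta> \<le> 1" and "\<delta> \<le> e / (4 * L)" using \<open>e > 0\<close> L by (auto simp: \<delta>_def)
  then have \<delta>L: "\<delta> * L \<le> e / 4" using L by (simp add: field_simps)
  obtain d1 where "d1 > 0"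
    and d1: "\<And>u. t < u \<Longrightarrow> u < t + d1 \<Longrightarrow> norm (x u - x t - (u - t) *\<^sub>R f) \<le> \<delta> * (u - t)"
    using has_vector_derivative_right_expansion[OF der t \<delta>(1)] unfolding f_def by blast
  let ?p = "P (x t)"
  obtain d2 where "d2 > 0"
    and d2: "\<And>z. norm (z - ?p) < d2 \<Longrightarrow> \<bar>\<Phi> z - \<Phi> ?p - (z - ?p) \<bullet> grad ?p\<bar> \<le> \<delta> * norm (z - ?p)"
    using has_derivative_objective[OF P_in, of "x t"] \<delta>(1) unfolding has_derivative_at_alt real_norm_def by blast
  define d where "d = min d1 (min (d2 / L) (e * K / (2 * L\<^sup>2)))"
  have "d > 0" using \<open>d1 > 0\<close> \<open>d2 > 0\<close> L \<open>e > 0\<close> K_pos by (simp add: d_def)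
  have "\<Phi> (P (x u)) - \<Phi> ?p + 2 * c * norm (P (x u) - ?p) \<le> (c\<^sup>2 + e) * (u - t)"
    if u: "t < u" "u < t + d" for u
  proof -
    define h where "h = u - t"
    define r where "r = x u - x t - h *\<^sub>R f"
    define \<Delta> where "\<Delta> = P (x u) - ?p"
    have h: "h > 0" "h < d1" "h < d2 / L" "h < e * K / (2 * L\<^sup>2)" using u by (auto simp: h_def d_def)
    have hL: "h * L < d2" and hL2: "L\<^sup>2 * h / K \<le> e / 2"
      using h(3,4) L K_pos by (auto simp: field_simps)
    have r: "norm r \<le> \<delta> * h" using d1[of u] h u by (simp add: r_def h_def)
    have D: "x u - x t = h *\<^sub>R f + r" by (simp add: r_def)
    have "norm (x u - x t) \<le> h * norm f + \<delta> * h"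
      unfolding D using norm_triangle_ineq[of "h *\<^sub>R f" r] r h by simp
    also have "\<dots> \<le> h * L" using \<delta>(2) h(1) by (simp add: L_def algebra_simps)
    finally have DL: "norm (x u - x t) \<le> h * L" .
    then have \<Delta>L: "norm \<Delta> \<le> h * L" unfolding \<Delta>_def using P_nonexpansive order_trans by blast
    \<comment> \<open>Firm nonexpansiveness brings in the field. Its residual part, paired with
      \<open>\<Delta>\<close>, is of second order, so the gradient pairing is what remains, and it
      governs the change of \<open>\<Phi>\<close>.\<close>
    have "norm \<Delta> ^ 2 \<le> \<Delta> \<bullet> (h *\<^sub>R f + r)"
      using projection_increment(1)[of "x u" "x t"] unfolding \<Delta>_def D .
    also have "\<dots> = - h * (\<Delta> \<bullet> grad ?p) + (h / K) * (- ((x t - ?p) \<bullet> \<Delta>)) + \<Delta> \<bullet> r"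
      unfolding f_def projected_field_def
      by (simp add: inner_add_right inner_diff_right inner_commute algebra_simps)
    also have "\<dots> \<le> - h * (\<Delta> \<bullet> grad ?p) + (h / K) * ((h * L) * (h * L)) + (h * L) * (\<delta> * h)"
    proof (intro add_mono order_refl mult_left_mono)
      have "- ((x t - ?p) \<bullet> \<Delta>) \<le> norm (x u - x t) * norm \<Delta>"
        using projection_increment(2)[of "x t" "x u"] by (simp add: \<Delta>_def)
      also have "\<dots> \<le> (h * L) * (h * L)"
        using DL \<Delta>L h(1) L by (intro mult_mono) auto
      finally show "- ((x t - ?p) \<bullet> \<Delta>) \<le> (h * L) * (h * L)" .
      have "\<Delta> \<bullet> r \<le> norm \<Delta> * norm r" by (rule norm_cauchy_schwarz)
      also have "\<dots> \<le> (h * L) * (\<delta> * h)"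
        using \<Delta>L r h(1) L by (intro mult_mono) auto
      finally show "\<Delta> \<bullet> r \<le> (h * L) * (\<delta> * h)" .
    qed (use h K_pos in auto)
    finally have 1: "h * (\<Delta> \<bullet> grad ?p) \<le> - (norm \<Delta> ^ 2) + h\<^sup>2 * (L\<^sup>2 * h / K) + h\<^sup>2 * (\<delta> * L)"
      by (simp add: power2_eq_square algebra_simps)
    have "\<Phi> (P (x u)) - \<Phi> ?p \<le> \<Delta> \<bullet> grad ?p + \<delta> * norm \<Delta>"
      using d2[of "P (x u)"] \<Delta>L hL unfolding \<Delta>_def by linarith
    also have "\<delta> * norm \<Delta> \<le> \<delta> * (h * L)" using \<Delta>L \<delta>(1) by (intro mult_left_mono) auto
    finally have "h * (\<Phi> (P (x u)) - \<Phi> ?p) \<le> h * (\<Delta> \<bullet> grad ?p + \<delta> * (h * L))"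
      using h(1) by (intro mult_left_mono) auto
    then have 2: "h * (\<Phi> (P (x u)) - \<Phi> ?p) \<le> h * (\<Delta> \<bullet> grad ?p) + h\<^sup>2 * (\<delta> * L)"
      by (simp add: power2_eq_square algebra_simps)
    have 3: "2 * c * h * norm \<Delta> \<le> c\<^sup>2 * h\<^sup>2 + norm \<Delta> ^ 2"
      using zero_le_power2[of "c * h - norm \<Delta>"] by (simp add: power2_eq_square algebra_simps)
    have 4: "h\<^sup>2 * (L\<^sup>2 * h / K) \<le> h\<^sup>2 * (e / 2)" "h\<^sup>2 * (\<delta> * L) \<le> h\<^sup>2 * (e / 4)"
      using hL2 \<delta>L by (intro mult_left_mono; simp)+
    have "h * (\<Phi> (P (x u)) - \<Phi> ?p + 2 * c * norm \<Delta>) \<le> c\<^sup>2 * h\<^sup>2 + h\<^sup>2 * e"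
    proof -
      have "h * (\<Phi> (P (x u)) - \<Phi> ?p + 2 * c * norm \<Delta>)
          = h * (\<Phi> (P (x u)) - \<Phi> ?p) + 2 * c * h * norm \<Delta>"
        by (simp add: distrib_left)
      moreover have "h\<^sup>2 * (e / 2) + 2 * (h\<^sup>2 * (e / 4)) = h\<^sup>2 * e" by simp
      ultimately show ?thesis using 1 2 3 4 by linarith
    qed
    also have "\<dots> = h * ((c\<^sup>2 + e) * h)" by (simp add: power2_eq_square algebra_simps)
    finally show ?thesis using h(1) by (simp add: \<Delta>_def h_def)
  qed
  then show ?thesis
    unfolding eventually_at_right_field using \<open>d > 0\<close> by (intro exI[of _ "t + d"]) auto
qed

text \<open>Integrates the local estimate; the triangle inequality permits measuring displacement
  from the fixed time \<open>a\<close>. The case \<open>c = 0\<close> is monotonicity of the energy,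
  while positive \<open>c\<close> turns a small energy drop into a small displacement.\<close>

lemma energy_inequality:
  assumes "a \<le> b" "solves a b x" "c \<ge> 0"
  shows "\<Phi> (P (x b)) - \<Phi> (P (x a)) + 2 * c * norm (P (x b) - P (x a)) \<le> c\<^sup>2 * (b - a)"
proof -
  define \<psi> where "\<psi> = (\<lambda>u. \<Phi> (P (x u)) + 2 * c * norm (P (x u) - P (x a)) - c\<^sup>2 * u)"
  have cP: "continuous_on {a..b} (\<lambda>t. P (x t))"
    by (intro continuous_on_compose2[OF continuous_on_P solves_continuous_on[OF assms(2)]]) auto
  have "\<psi> b \<le> \<psi> a"
  proof (rule right_Dini_nonpos_imp_le[OF \<open>a \<le> b\<close>])
    show "continuous_on {a..b} \<psi>"
      unfolding \<psi>_def
      by (intro continuous_intros cP continuous_on_compose2[OF continuous_on_objective cP]) (auto simp: P_in)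
    fix t e :: real assume t: "a \<le> t" "t < b" and "e > 0"
    then have "(x has_vector_derivative F (x t)) (at t within {a..b})"
      using assms(2) by (auto simp: solves_def)
    from energy_right_Dini[OF this t \<open>e > 0\<close>, of c]
    show "\<forall>\<^sub>F u in at_right t. \<psi> u \<le> \<psi> t + e * (u - t)"
    proof eventually_elim
      case (elim u)
      have "norm (P (x u) - P (x a)) \<le> norm (P (x u) - P (x t)) + norm (P (x t) - P (x a))"
        using norm_triangle_ineq[of "P (x u) - P (x t)" "P (x t) - P (x a)"] by simp
      then have "2 * c * norm (P (x u) - P (x a))
          \<le> 2 * c * (norm (P (x u) - P (x t)) + norm (P (x t) - P (x a)))"
        using \<open>c \<ge> 0\<close> by (intro mult_left_mono) auto
      then show ?case using elim by (simp add: \<psi>_def algebra_simps)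
    qed
  qed
  then show ?thesis by (simp add: \<psi>_def algebra_simps)
qed

text \<open>Once the residual has reached size \<open>K * G\<close>, its decay at rate
  \<open>1 / K\<close> outweighs a gradient of norm at most \<open>G\<close>, so \<open>E\<close>
  acts as a barrier.\<close>

lemma residual_bound:
  assumes "a \<le> b" "solves a b x"
    and G: "\<And>t. t \<in> {a..b} \<Longrightarrow> norm (grad (P (x t))) \<le> G"
    and E: "K * G \<le> E" "norm (x a - P (x a)) \<le> E"
  shows "norm (x b - P (x b)) \<le> E"
proof -
  \<comment> \<open>Below \<open>E\<close> the residual may grow; truncating at \<open>E\<close>
    gives a nonincreasing quantity.\<close>
  define m where "m = (\<lambda>u. max (norm (x u - P (x u))) E)"
  have cx: "continuous_on {a..b} x" by (rule solves_continuous_on[OF assms(2)])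
  then have cP: "continuous_on {a..b} (\<lambda>t. P (x t))"
    by (intro continuous_on_compose2[OF continuous_on_P]) auto
  have "m b \<le> m a"
  proof (rule right_Dini_nonpos_imp_le[OF \<open>a \<le> b\<close>])
    show "continuous_on {a..b} m"
      unfolding m_def by (intro continuous_on_max continuous_intros cx cP)
    fix t e :: real assume t: "a \<le> t" "t < b" and "e > 0"
    then have "(x has_vector_derivative F (x t)) (at t within {a..b})"
      using assms(2) by (auto simp: solves_def)
    from has_vector_derivative_right_expansion[OF this t \<open>e > 0\<close>]
    obtain d where "d > 0" and
      d: "\<And>u. t < u \<Longrightarrow> u < t + d \<Longrightarrow> norm (x u - x t - (u - t) *\<^sub>R F (x t)) \<le> e * (u - t)" by blast
    \<comment> \<open>Steps shorter than \<open>K\<close> keep the contraction factor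
      \<open>1 - h / K\<close> nonnegative.\<close>
    have "m u \<le> m t + e * (u - t)" if u: "t < u" "u < t + min d K" for u
    proof -
      define h where "h = u - t"
      define r where "r = x u - x t - h *\<^sub>R F (x t)"
      have h: "0 < h" "h < K" using u by (auto simp: h_def)
      have r: "norm r \<le> e * h" using d[of u] u by (simp add: r_def h_def)
      have "G \<le> m t / K" using E(1) K_pos by (simp add: m_def field_simps max_def)
      then have hG: "h * G \<le> h * (m t / K)" using h by (intro mult_left_mono) auto
      \<comment> \<open>Comparing with the old projection point avoids differentiating
        \<open>P\<close>.\<close>
      have "norm (x u - P (x u)) \<le> norm (x u - P (x t))"
        using closest_point_le[OF closed P_in] by (simp add: dist_norm)
      also have "x u - P (x t) = ((1 - h / K) *\<^sub>R (x t - P (x t)) - h *\<^sub>R grad (P (x t))) + r"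
        by (simp add: r_def projected_field_def algebra_simps)
      also have "norm \<dots> \<le> ((1 - h / K) * norm (x t - P (x t)) + h * norm (grad (P (x t)))) + norm r"
      proof (rule order_trans[OF norm_triangle_ineq], rule add_right_mono,
             rule order_trans[OF norm_triangle_ineq4])
        have "\<bar>1 - h / K\<bar> = 1 - h / K" using h by (simp add: field_simps)
        then show "norm ((1 - h / K) *\<^sub>R (x t - P (x t))) + norm (h *\<^sub>R grad (P (x t)))
            \<le> (1 - h / K) * norm (x t - P (x t)) + h * norm (grad (P (x t)))"
          using h by simp
      qed
      also have "\<dots> \<le> ((1 - h / K) * m t + h * G) + e * h"
      proof (intro add_mono mult_left_mono r)
        show "norm (grad (P (x t))) \<le> G" using G t by simp
      qed (use h in \<open>auto simp: m_def field_simps\<close>)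
      also have "\<dots> \<le> m t + e * h" using hG by (simp add: algebra_simps)
      finally have "norm (x u - P (x u)) \<le> m t + e * h" .
      moreover have "E \<le> m t + e * h" using h \<open>e > 0\<close> by (simp add: m_def max_def add_increasing2)
      ultimately show ?thesis by (simp add: m_def h_def)
    qed
    then show "\<forall>\<^sub>F u in at_right t. m u \<le> m t + e * (u - t)"
      unfolding eventually_at_right_field using \<open>d > 0\<close> K_pos
      by (intro exI[of _ "t + min d K"]) auto
  qed
  then show ?thesis using E(2) by (simp add: m_def max_def split: if_splits)
qed

text \<open>The bound depends on the initial point alone, not on the time or the solution; this lets
  a truncation radius be fixed before a solution is known. Monotone energy confines the projection
  to a compact sublevel set, where the gradient is bounded, and the barrier for the residual does
  the rest.\<close>

lemma bounded_solutions:
  "\<exists>B. \<forall>T x. 0 \<le> T \<longrightarrow> solves 0 T x \<longrightarrow> x 0 = x0 \<longrightarrow> norm (x T) \<le> B"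
proof -
  define S where "S = {z \<in> C. \<Phi> z \<le> \<Phi> (P x0)}"
  have S: "compact S" unfolding S_def by (rule sublevel)
  obtain B where B: "\<And>z. z \<in> S \<Longrightarrow> norm z \<le> B"
    using compact_imp_bounded[OF S] unfolding bounded_iff by blast
  have "compact (grad ` S)"
    by (intro compact_continuous_image S continuous_on_subset[OF continuous_on_grad]) (auto simp: S_def)
  then obtain G where G: "\<And>z. z \<in> S \<Longrightarrow> norm (grad z) \<le> G"
    using compact_imp_bounded[of "grad ` S"] unfolding bounded_iff by blast
  define E where "E = max (K * G) (norm (x0 - P x0))"
  show ?thesis
  proof (intro exI[of _ "B + E"] allI impI)
    fix T x assume T: "0 \<le> T" "solves 0 T x" "x 0 = x0"
    have PS: "P (x t) \<in> S" if "t \<in> {0..T}" for t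
      using energy_inequality[of 0 t x 0] solves_subinterval[OF T(2), of 0 t] that T(3) P_in
      by (simp add: S_def)
    have "norm (x T - P (x T)) \<le> E"
      by (rule residual_bound[OF T(1,2), of G]) (use PS G T(3) in \<open>auto simp: E_def\<close>)
    moreover have "norm (P (x T)) \<le> B" using PS[of T] B T(1) by simp
    ultimately show "norm (x T) \<le> B + E"
      using norm_triangle_ineq[of "x T - P (x T)" "P (x T)"] by simp
  qed
qed

section \<open>Asymptotic behaviour of the projected trajectory\<close>

lemma projection_asymptotically_slow:
  assumes sol: "\<And>T. solves 0 T x" and "T > 0" "\<rho> > 0"
  obtains t0 where "t0 \<ge> 0"
    "\<And>s t. t0 \<le> s \<Longrightarrow> s \<le> t \<Longrightarrow> t \<le> s + T \<Longrightarrow> norm (P (x t) - P (x s)) \<le> \<rho>"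
proof -
  let ?\<phi> = "\<lambda>t. \<Phi> (P (x t))"
  have sol': "solves s t x" if "0 \<le> s" for s t
    using solves_subinterval[OF sol, of s t t] that by simp
  have mono: "?\<phi> t \<le> ?\<phi> s" if "0 \<le> s" "s \<le> t" for s t
    using energy_inequality[OF \<open>s \<le> t\<close> sol'[OF \<open>0 \<le> s\<close>], of 0] by simp
  define S where "S = {z \<in> C. \<Phi> z \<le> ?\<phi> 0}"
  have "compact (\<Phi> ` S)" unfolding S_def
    by (intro compact_continuous_image sublevel continuous_on_subset[OF continuous_on_objective]) auto
  moreover have "?\<phi> ` {0..} \<subseteq> \<Phi> ` S"
    using mono[of 0] P_in by (auto simp: S_def)
  ultimately have bdd: "bdd_below (?\<phi> ` {0..})"
    by (meson bdd_below_mono bounded_imp_bdd_below compact_imp_bounded)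
  define l where "l = Inf (?\<phi> ` {0..})"
  have l: "l \<le> ?\<phi> t" if "t \<ge> 0" for t
    unfolding l_def using that by (intro cInf_lower bdd) auto
  \<comment> \<open>This is the energy drop tolerated after \<open>t0\<close>. The energy inequality
    with \<open>c = \<rho> / T\<close> contributes the same amount over a window of length
    \<open>T\<close>, and the sum is exactly \<open>2 * c * \<rho>\<close>.\<close>
  have "\<rho>\<^sup>2 / T > 0" using assms by simp
  then have "Inf (?\<phi> ` {0..}) < l + \<rho>\<^sup>2 / T" by (simp add: l_def)
  then obtain t0 where t0: "t0 \<ge> 0" "?\<phi> t0 < l + \<rho>\<^sup>2 / T"
    using cInf_lessD[of "?\<phi> ` {0..}"] by auto
  show thesis
  proof (rule that[OF t0(1)])
    fix s t assume st: "t0 \<le> s" "s \<le> t" "t \<le> s + T"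
    let ?n = "norm (P (x t) - P (x s))"
    have "?\<phi> s - ?\<phi> t \<le> \<rho>\<^sup>2 / T" using t0 mono[of t0 s] l[of t] st by linarith
    moreover have "?\<phi> t - ?\<phi> s + 2 * (\<rho> / T) * ?n \<le> (\<rho> / T)\<^sup>2 * (t - s)"
      using energy_inequality[OF st(2) sol', of "\<rho> / T"] st t0 assms by simp
    moreover have "(\<rho> / T)\<^sup>2 * (t - s) \<le> (\<rho> / T)\<^sup>2 * T"
      using st by (intro mult_left_mono) auto
    moreover have "(\<rho> / T)\<^sup>2 * T = \<rho>\<^sup>2 / T" using \<open>T > 0\<close> by (simp add: power2_eq_square)
    ultimately have "2 * (\<rho> / T) * ?n \<le> 2 * (\<rho>\<^sup>2 / T)" by linarith
    then show "?n \<le> \<rho>" using assms by (simp add: power2_eq_square field_simps)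
  qed
qed

text \<open>Tangent vectors are limits of positive multiples of \<open>y - p\<close> with
  \<open>y\<close> in \<open>C\<close>, so the variational inequality passes to the tangent
  cone.\<close>

lemma critical_pointI:
  assumes "p \<in> C" "\<And>v. v \<in> C \<Longrightarrow> grad p \<bullet> (v - p) \<ge> 0"
  shows "p \<in> critical_points \<Phi> C"
proof -
  have "- grad p \<in> normal_cone C p"
    unfolding normal_cone_def polar_cone_def
  proof clarify
    fix v assume "v \<in> tangent_cone C p"
    then obtain y \<delta> where y: "\<And>k. y k \<in> C" and \<delta>: "\<And>k::nat. \<delta> k > (0::real)"
      and lim: "(\<lambda>k. (y k - p) /\<^sub>R \<delta> k) \<longlonglongrightarrow> v"
      unfolding tangent_cone_def by blast
    have "- grad p \<bullet> ((y k - p) /\<^sub>R \<delta> k) \<le> 0" for k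
      using assms(2)[OF y, of k] \<delta>[of k] by simp
    then show "- grad p \<bullet> v \<le> 0"
      by (intro tendsto_upperbound[OF tendsto_inner[OF tendsto_const lim]]) auto
  qed
  then show ?thesis
    using assms(1) unfolding critical_points_def by (auto intro!: image_eqI[of _ _ "- grad p"])
qed

lemma limit_point_critical:
  assumes sol: "\<And>T. solves 0 T x" and \<tau>: "filterlim \<tau> at_top sequentially"
    and lim: "(\<lambda>k. P (x (\<tau> k))) \<longlonglongrightarrow> p"
  shows "p \<in> critical_points \<Phi> C"
proof (rule critical_pointI)
  show p: "p \<in> C" using closed_sequentially[OF closed _ lim] P_in by blast
  fix v assume v: "v \<in> C"
  define w where "w = v - p"
  show "grad p \<bullet> (v - p) \<ge> 0"
  proof (rule ccontr)
    assume "\<not> grad p \<bullet> (v - p) \<ge> 0"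
    \<comment> \<open>The initial rate \<open>2 * \<eta>\<close> leaves room for losing
      \<open>\<eta> / 2\<close> to the variation of the gradient and \<open>\<eta> / 2\<close> to
      the residual.\<close>
    define \<eta> where "\<eta> = - (grad p \<bullet> w) / 2"
    have \<eta>: "\<eta> > 0" "- (grad p \<bullet> w) = 2 * \<eta>"
      using \<open>\<not> grad p \<bullet> (v - p) \<ge> 0\<close> by (auto simp: \<eta>_def w_def)
    obtain B where B: "\<And>T. 0 \<le> T \<Longrightarrow> norm (x T) \<le> B"
      using bounded_solutions[of "x 0"] sol by metis
    have B0: "B \<ge> 0" using B[of 0] norm_ge_zero[of "x 0"] by linarith
    define E where "E = B + (norm p + 1)"
    have E: "E > 0" using B0 by (simp add: E_def add_nonneg_pos)
    \<comment> \<open>Growth at rate \<open>\<eta>\<close> over this time exceeds by 1 the largest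
      change of \<open>x \<bullet> w\<close> compatible with the bound \<open>B\<close>.\<close>
    define T where "T = (2 * B * norm w + 1) / \<eta>"
    have T: "T > 0" "\<eta> * T = 2 * B * norm w + 1" using \<eta>(1) B0 by (auto simp: T_def add_nonneg_pos)
    have "\<eta> / (2 * (norm w + 1)) > 0" using \<eta>(1) by (simp add: add_nonneg_pos)
    then obtain \<rho>1 where "\<rho>1 > 0"
      and \<rho>1: "\<And>z. z \<in> C \<Longrightarrow> norm (z - p) < \<rho>1 \<Longrightarrow> norm (grad z - grad p) < \<eta> / (2 * (norm w + 1))"
      using continuous_on_grad p unfolding continuous_on_iff dist_norm by meson
    \<comment> \<open>In order: closeness of the gradient to \<open>grad p\<close>, the bound
      \<open>E\<close> on the residual, and smallness of the residual paired with
      \<open>P (x t) - p\<close>. One half of \<open>\<rho>\<close> is spent on reaching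
      \<open>p\<close>, the other on drift during the window.\<close>
    define \<rho> where "\<rho> = min (min \<rho>1 1) (\<eta> * K / (2 * E))"
    have \<rho>: "\<rho> > 0" "\<rho> \<le> \<rho>1" "\<rho> \<le> 1" "\<rho> \<le> \<eta> * K / (2 * E)"
      using \<open>\<rho>1 > 0\<close> \<eta>(1) K_pos E by (auto simp: \<rho>_def)
    obtain t0 where t0: "t0 \<ge> 0"
      and slow: "\<And>s t. t0 \<le> s \<Longrightarrow> s \<le> t \<Longrightarrow> t \<le> s + T \<Longrightarrow> norm (P (x t) - P (x s)) \<le> \<rho> / 2"
      using projection_asymptotically_slow[OF sol T(1), of "\<rho> / 2"] \<rho>(1) by auto
    have "\<forall>\<^sub>F k in sequentially. \<tau> k \<ge> t0 \<and> norm (P (x (\<tau> k)) - p) < \<rho> / 2"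
      using \<tau> tendstoD[OF lim, of "\<rho> / 2"] \<rho>(1)
      by (auto simp: filterlim_at_top dist_norm intro: eventually_conj)
    then obtain s where s: "s \<ge> t0" "norm (P (x s) - p) < \<rho> / 2"
      by (auto simp: eventually_sequentially)
    have rate: "F (x t) \<bullet> w \<ge> \<eta>" if t: "t \<in> {s..s + T}" for t
    proof -
      let ?e = "x t - P (x t)"
      have near: "norm (P (x t) - p) < \<rho>"
        using slow[of s t] s t norm_triangle_ineq[of "P (x t) - P (x s)" "P (x s) - p"] by simp
      have "norm (P (x t)) \<le> norm p + 1"
        using near \<rho>(3) norm_triangle_ineq[of "P (x t) - p" p] by simp
      then have eE: "norm ?e \<le> E"
        using B[of t] t s t0 norm_triangle_ineq4[of "x t" "P (x t)"] by (simp add: E_def)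
      have "norm (grad (P (x t)) - grad p) < \<eta> / (2 * (norm w + 1))"
        using \<rho>1[OF P_in] near \<rho>(2) by simp
      then have "norm (grad (P (x t)) - grad p) * norm w \<le> \<eta> / (2 * (norm w + 1)) * (norm w + 1)"
        using \<open>\<eta> / (2 * (norm w + 1)) > 0\<close> by (intro mult_mono) auto
      also have "\<dots> = \<eta> / 2"
        using norm_ge_zero[of w] by (simp add: field_simps add_nonneg_eq_0_iff)
      finally have 1: "(grad (P (x t)) - grad p) \<bullet> w \<le> \<eta> / 2"
        using norm_cauchy_schwarz[of "grad (P (x t)) - grad p" w] by linarith
      \<comment> \<open>The residual itself need not be small: its pairing with
        \<open>v - P (x t)\<close> has the right sign, and only the second term has to be
        estimated.\<close>
      have "?e \<bullet> w = ?e \<bullet> (v - P (x t)) + ?e \<bullet> (P (x t) - p)"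
        by (simp add: w_def inner_diff_right)
      also have "\<dots> \<le> norm ?e * norm (P (x t) - p)"
        using P_dot[OF v, of "x t"] norm_cauchy_schwarz[of ?e "P (x t) - p"] by linarith
      also have "\<dots> \<le> E * (\<eta> * K / (2 * E))"
        using eE near \<rho>(4) E by (intro mult_mono) auto
      also have "\<dots> = K * (\<eta> / 2)" using E by simp
      finally have 2: "?e \<bullet> w / K \<le> \<eta> / 2" using K_pos by (simp add: field_simps)
      have "F (x t) \<bullet> w = - (grad p \<bullet> w) - (grad (P (x t)) - grad p) \<bullet> w - ?e \<bullet> w / K"
        by (simp add: projected_field_def inner_diff_left)
      then show ?thesis using 1 2 \<eta>(2) by linarith
    qed
    have "s \<ge> 0" using s t0 by simp
    have "((\<lambda>t. x t \<bullet> w) has_derivative (\<lambda>h. h * (F (x t) \<bullet> w))) (at t within {s..s + T})"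
      if "t \<in> {s..s + T}" for t
    proof -
      have "solves s (s + T) x" using solves_subinterval[OF sol, of s "s + T"] \<open>s \<ge> 0\<close> by blast
      then have "(x has_derivative (\<lambda>h. h *\<^sub>R F (x t))) (at t within {s..s + T})"
        using that by (auto simp: solves_def has_vector_derivative_def)
      from has_derivative_inner_left[OF this, of w] show ?thesis by simp
    qed
    then obtain t where "t \<in> {s..s + T}" "x (s + T) \<bullet> w - x s \<bullet> w = T * (F (x t) \<bullet> w)"
      using mvt_very_simple[of s "s + T" "\<lambda>t. x t \<bullet> w" "\<lambda>t h. h * (F (x t) \<bullet> w)"] T(1) by auto
    then have "x (s + T) \<bullet> w - x s \<bullet> w \<ge> \<eta> * T"
      using rate[of t] T(1) by (simp add: mult.commute)
    moreover have "\<bar>x u \<bullet> w\<bar> \<le> B * norm w" if "u \<ge> 0" for u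
      using Cauchy_Schwarz_ineq2[of "x u" w] mult_right_mono[OF B[OF that], of "norm w"] by simp
    from this[of s] this[of "s + T"] have "x (s + T) \<bullet> w - x s \<bullet> w \<le> 2 * B * norm w"
      using T(1) \<open>s \<ge> 0\<close> by simp
    ultimately show False
      using T(2) by simp
  qed
qed

text \<open>Compactness of the initial sublevel set supplies the subsequence. The result serves
  twice: for nonemptiness of the critical set and for convergence to it.\<close>

lemma limit_points_exist:
  assumes sol: "\<And>T. solves 0 T x" and \<tau>: "filterlim \<tau> at_top sequentially" "\<And>k. \<tau> k \<ge> 0"
  obtains r p where "strict_mono (r :: nat \<Rightarrow> nat)" "p \<in> critical_points \<Phi> C"
    "(\<lambda>k. P (x (\<tau> (r k)))) \<longlonglongrightarrow> p"
proof -
  define S where "S = {z \<in> C. \<Phi> z \<le> \<Phi> (P (x 0))}"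
  have "P (x (\<tau> k)) \<in> S" for k
    using energy_inequality[OF \<tau>(2) sol, of 0 k] P_in by (simp add: S_def)
  moreover have "seq_compact S"
    using sublevel unfolding S_def by (simp add: compact_eq_seq_compact_metric)
  ultimately obtain p r where r: "strict_mono (r :: nat \<Rightarrow> nat)" "((\<lambda>k. P (x (\<tau> k))) \<circ> r) \<longlonglongrightarrow> p"
    unfolding seq_compact_def by metis
  then have lim: "(\<lambda>k. P (x (\<tau> (r k)))) \<longlonglongrightarrow> p" by (simp add: o_def)
  have "filterlim (\<lambda>k. \<tau> (r k)) at_top sequentially"
    using filterlim_compose[OF \<tau>(1) filterlim_subseq[OF r(1)]] .
  from limit_point_critical[OF sol this lim] show thesis using that[OF r(1) _ lim] by blast
qed

theorem projected_trajectory_converges: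
  assumes sol: "\<And>T. solves 0 T x"
  shows "converges_to_set (P \<circ> x) (critical_points \<Phi> C)"
  unfolding converges_to_set_def
proof
  have "filterlim (\<lambda>k. real k) at_top sequentially" by (rule filterlim_real_sequentially)
  from limit_points_exist[OF sol this] show "critical_points \<Phi> C \<noteq> {}" by auto
  show "((\<lambda>t. infdist ((P \<circ> x) t) (critical_points \<Phi> C)) \<longlongrightarrow> 0) at_top"
  proof (rule ccontr)
    assume "\<not> ?thesis"
    then obtain e where "e > 0"
      and e: "\<not> (\<forall>\<^sub>F t in at_top. infdist (P (x t)) (critical_points \<Phi> C) < e)"
      by (auto simp: tendsto_iff dist_real_def infdist_nonneg)
    \<comment> \<open>Arbitrarily late times at distance at least \<open>e\<close> have a limit
      point that is critical, which contradicts continuity of the distance.\<close>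
    have "\<exists>t. t \<ge> real k \<and> infdist (P (x t)) (critical_points \<Phi> C) \<ge> e" for k
      using e unfolding eventually_at_top_linorder by (meson not_le)
    then obtain \<tau> where \<tau>: "\<And>k. \<tau> k \<ge> real k" "\<And>k. infdist (P (x (\<tau> k))) (critical_points \<Phi> C) \<ge> e"
      by metis
    have "filterlim \<tau> at_top sequentially"
      using filterlim_at_top_mono[OF filterlim_real_sequentially] \<tau>(1) by simp
    moreover have "\<tau> k \<ge> 0" for k using \<tau>(1)[of k] by linarith
    ultimately obtain r p where p: "p \<in> critical_points \<Phi> C" and lim: "(\<lambda>k. P (x (\<tau> (r k)))) \<longlonglongrightarrow> p"
      by (rule limit_points_exist[OF sol])
    have "(\<lambda>k. infdist (P (x (\<tau> (r k)))) (critical_points \<Phi> C)) \<longlonglongrightarrow> infdist p (critical_points \<Phi> C)"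
      by (intro tendsto_infdist lim)
    then have "e \<le> infdist p (critical_points \<Phi> C)"
      by (rule tendsto_lowerbound) (use \<tau>(2) in auto)
    then show False using p \<open>e > 0\<close> by simp
  qed
qed

subsection \<open>Global existence\<close>

text \<open>Peano's theorem applies to a bounded modification of the field, and the a priori bound
  shows that its solution never reaches the region where the field was modified.\<close>

lemma global_solution_exists:
  "\<exists>x. x 0 = x0 \<and> (\<forall>T. solves 0 T x)"
proof -
  obtain B where B: "\<And>T x. 0 \<le> T \<Longrightarrow> solves 0 T x \<Longrightarrow> x 0 = x0 \<Longrightarrow> norm (x T) \<le> B"
    using bounded_solutions by blast
  define R where "R = max B (norm x0) + 1"
  have R: "B < R" "norm x0 < R" and ball: "convex (cball (0::'a) R)" "closed (cball (0::'a) R)" "cball (0::'a) R \<noteq> {}"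
    using norm_ge_zero[of x0] by (auto simp: R_def simp del: norm_ge_zero)
  \<comment> \<open>Precomposing with the projection onto a ball keeps continuity, makes the field
    bounded and leaves it unchanged on the ball, whose radius strictly exceeds the a priori
    bound.\<close>
  define H where "H = (\<lambda>y. F (closest_point (cball 0 R) y))"
  have contH: "continuous_on UNIV H"
    unfolding H_def
    by (rule continuous_on_compose2[OF continuous_on_field continuous_on_closest_point[OF ball]]) auto
  have "compact (F ` cball 0 R)"
    by (intro compact_continuous_image continuous_on_subset[OF continuous_on_field]) auto
  then obtain M where M: "\<And>y. y \<in> cball 0 R \<Longrightarrow> norm (F y) \<le> M"
    using compact_imp_bounded[of "F ` cball 0 R"] unfolding bounded_iff by blast
  have "norm (H y) \<le> M" for y
    unfolding H_def by (intro M closest_point_in_set ball)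
  from Peano_existence[OF contH this, of x0] obtain x where x0: "x 0 = x0"
    and x: "\<And>T t. t \<in> {0..T} \<Longrightarrow> (x has_vector_derivative H (x t)) (at t within {0..T})"
    by blast
  have contx: "continuous_on {0..T} x" for T
    by (rule continuous_on_vector_derivative) (rule x)
  have solves_inside: "solves 0 T x" if "\<And>t. t \<in> {0..T} \<Longrightarrow> norm (x t) < R" for T
    unfolding solves_def
  proof
    fix t assume t: "t \<in> {0..T}"
    then have "H (x t) = F (x t)" using that[OF t] by (simp add: H_def closest_point_self)
    then show "(x has_vector_derivative F (x t)) (at t within {0..T})" using x[OF t] by simp
  qed
  have inside: "norm (x t) < R" if "t \<ge> 0" for t
  proof (rule ccontr)
    assume t: "\<not> norm (x t) < R"
    define A where "A = {s \<in> {0..t}. R \<le> norm (x s)}"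
    have "closed A"
      unfolding A_def by (intro continuous_on_closed_Collect_le continuous_intros contx closed_atLeastAtMost)
    moreover have "A \<noteq> {}" "bdd_below A" using t \<open>t \<ge> 0\<close> by (auto simp: A_def)
    ultimately have \<tau>: "Inf A \<in> A" by (simp add: closed_contains_Inf)
    define \<tau> where "\<tau> = Inf A"
    have "R \<le> norm (x \<tau>)" "0 \<le> \<tau>" "\<tau> \<le> t" using \<tau> by (auto simp: A_def \<tau>_def)
    then have "\<tau> > 0" using x0 R(2) by (cases "\<tau> = 0") auto
    \<comment> \<open>Before the first exit time \<open>\<tau>\<close> the curve solves the original
      system, so it is bounded by \<open>B\<close>; continuity extends this to
      \<open>\<tau>\<close>, where the norm should be at least \<open>R\<close>.\<close>
    have early: "norm (x s) < R" if "s \<in> {0..<\<tau>}" for s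
      using that \<open>\<tau> \<le> t\<close> cInf_lower[OF _ \<open>bdd_below A\<close>, of s] by (force simp: A_def \<tau>_def)
    have "norm (x s) \<le> B" if "s \<in> {0..<\<tau>}" for s
      using that early by (intro B solves_inside x0) auto
    moreover have "closure {0..<\<tau>} = {0..\<tau>}" using \<open>\<tau> > 0\<close> by simp
    ultimately have "norm (x \<tau>) \<le> B"
      using contx[of \<tau>] \<open>\<tau> > 0\<close>
      by (intro continuous_on_closure_norm_le[of "{0..<\<tau>}" x B \<tau>]) auto
    then show False using \<open>R \<le> norm (x \<tau>)\<close> R(1) by simp
  qed
  have "solves 0 T x" for T
    by (rule solves_inside) (simp add: inside)
  then show ?thesis
    using x0 by blast
qed

text \<open>Transfers the classical results to solutions in the almost-everywhere sense; continuity
  of the field is what makes the notions agree.\<close>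

lemma complete_solution_iff_solves: "complete_solution F x \<longleftrightarrow> (\<forall>T. solves 0 T x)"
proof
  assume *: "complete_solution F x"
  show "\<forall>T. solves 0 T x"
  proof
    fix T :: real
    \<comment> \<open>\<open>ode_solution_on\<close> demands a positive horizon, whereas
      \<open>T\<close> is arbitrary here.\<close>
    have "ode_solution_on F (max T 1) x" using * by (simp add: complete_solution_def)
    then have "solves 0 (max T 1) x"
      unfolding solves_def using ode_solution_on_continuous_derivative[OF _ continuous_on_field] by blast
    then show "solves 0 T x" by (rule solves_subinterval) auto
  qed
next
  assume "\<forall>T. solves 0 T x"
  then show "complete_solution F x"
    unfolding complete_solution_def solves_def by (auto intro!: ode_solution_onI[OF _ continuous_on_field])
qed

end

theorem theorem3:
  fixes C :: "(real ^ 'n) set" and \<Phi> :: "real ^ 'n \<Rightarrow> real"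
  assumes "C \<noteq> {}" and "closed C" and "convex C"
    and "continuously_differentiable_near \<Phi> C"
    and "\<And>l :: real. compact {x \<in> C. \<Phi> x \<le> l}"
  shows "\<forall>K>0. \<forall>x0 :: real ^ 'n.
    (\<exists>x :: real \<Rightarrow> real ^ 'n. complete_solution (projected_field \<Phi> C K) x \<and> x 0 = x0) \<and>
    (\<forall>x :: real \<Rightarrow> real ^ 'n. complete_solution (projected_field \<Phi> C K) x \<and> x 0 = x0 \<longrightarrow>
       converges_to_set (closest_point C \<circ> x) (critical_points \<Phi> C))"
proof (intro allI impI conjI)
  fix K :: real and x0 :: "real ^ 'n"
  assume "K > 0"
  with assms interpret projected_gradient_system C \<Phi> K
    by unfold_locales
  show "\<exists>x. complete_solution (projected_field \<Phi> C K) x \<and> x 0 = x0"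
    using global_solution_exists[of x0] complete_solution_iff_solves by metis
  show "converges_to_set (closest_point C \<circ> x) (critical_points \<Phi> C)"
    if "complete_solution (projected_field \<Phi> C K) x \<and> x 0 = x0" for x
    using that complete_solution_iff_solves by (intro projected_trajectory_converges) blast
qed

end
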